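(* Let $G$ be a Polish group which has a comeagre conjugacy class, and suppose that (the abstract group) $G$ has a non-nesting action by weak homeomorphisms on a nonempty $\mathbb{R}$-tree $T$. Then every element of $G$ is elliptic, i.e. for every $g\in G$ there exists $x\in T$ with $g(x)=x$.
   Context: An $\mathbb{R}$-tree is a metric space $T$ such that for any $x\neq y$ in $T$ there is a unique topologically embedded arc joining $x$ to $y$, and this arc is isometric to some interval of $\mathbb{R}$. For $x\ne y$, $[x,y]$ denotes this arc, and $[x,x]=\{x\}$; the sets $[x,y]$ are called segments, and $(x,y)=[x,y]\setminus\{x,y\}$. A weak homeomorphism of $T$ is a bijection $g:T\to T$ preserving the betweenness relation $B(x;y,z)$ defined by $x\in(y,z)$. All actions on $T$ are group actions by weak homeomorphisms. An action of $G$ on $T$ is non-nesting if there is no segment $I\subseteq T$ and no $g\in G$ such that $g(I)\subsetneqq I$. An element $g\in G$ is elliptic if it fixes a point of $T$, and loxodromic otherwise. A Polish group is a topological group whose topology is Polish (separable and completely metrizable). A subset of a Polish space is comeagre if it contains the intersection of a countable family of dense open sets. No relation is assumed between the action of $G$ on $T$ and the topology of $G$ (no continuity of the action in $g$ is assumed). *)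

theory Defs
  imports "HOL-Analysis.Analysis" "HOL-Algebra.Group_Action"
begin

section \<open>Real trees\<close>

context Metric_space
begin

definition arc_joining :: "'a \<Rightarrow> 'a \<Rightarrow> 'a set \<Rightarrow> bool" where
  "arc_joining x y A \<longleftrightarrow>
     (\<exists>\<gamma>. embedding_map (top_of_set {0..1::real}) mtopology \<gamma> \<and>
          \<gamma> 0 = x \<and> \<gamma> 1 = y \<and> A = \<gamma> ` {0..1})"

definition isometric_to_interval :: "'a set \<Rightarrow> bool" where
  "isometric_to_interval A \<longleftrightarrow>
     (\<exists>J f. is_interval (J :: real set) \<and> f ` J = A \<and>
            (\<forall>s\<in>J. \<forall>t\<in>J. d (f s) (f t) = \<bar>s - t\<bar>))"

text \<open>Arcs are subsets of the space, not parametrisations. The definite description is meaningful only in an \<open>\<real>\<close>-tree (locale \<open>R_tree\<close> below),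
  where the arc joining two distinct points is unique as a set.\<close>

definition segment :: "'a \<Rightarrow> 'a \<Rightarrow> 'a set" where
  "segment x y = (if x = y then {x} else (THE A. arc_joining x y A))"

definition open_seg :: "'a \<Rightarrow> 'a \<Rightarrow> 'a set" where
  "open_seg x y = segment x y - {x, y}"

definition between :: "'a \<Rightarrow> 'a \<Rightarrow> 'a \<Rightarrow> bool" where
  "between x y z \<longleftrightarrow> x \<in> open_seg y z"

definition weak_homeomorphism :: "('a \<Rightarrow> 'a) \<Rightarrow> bool" where
  "weak_homeomorphism g \<longleftrightarrow> bij_betw g M M \<and>
     (\<forall>x\<in>M. \<forall>y\<in>M. \<forall>z\<in>M. between (g x) (g y) (g z) \<longleftrightarrow> between x y z)"

definition is_segment :: "'a set \<Rightarrow> bool" where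
  "is_segment I \<longleftrightarrow> (\<exists>x\<in>M. \<exists>y\<in>M. I = segment x y)"

end

locale R_tree = Metric_space +
  assumes unique_arc: "\<lbrakk>x \<in> M; y \<in> M; x \<noteq> y\<rbrakk> \<Longrightarrow> \<exists>!A. arc_joining x y A"
    and arc_isometric: "\<lbrakk>x \<in> M; y \<in> M; x \<noteq> y; arc_joining x y A\<rbrakk> \<Longrightarrow> isometric_to_interval A"


section \<open>Actions on real trees\<close>

locale R_tree_action = R_tree M d + group_action G M \<phi>
  for M :: "'a set" and d and G (structure) and \<phi> +
  assumes weak_homeo: "g \<in> carrier G \<Longrightarrow> weak_homeomorphism (\<phi> g)"

definition (in Metric_space) non_nesting :: "('g, 'm) monoid_scheme \<Rightarrow> ('g \<Rightarrow> 'a \<Rightarrow> 'a) \<Rightarrow> bool" where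
  "non_nesting G \<phi> \<longleftrightarrow> \<not> (\<exists>I. is_segment I \<and> (\<exists>g\<in>carrier G. \<phi> g ` I \<subset> I))"

definition elliptic :: "'a set \<Rightarrow> ('g \<Rightarrow> 'a \<Rightarrow> 'a) \<Rightarrow> 'g \<Rightarrow> bool" where
  "elliptic T \<phi> g \<longleftrightarrow> (\<exists>x\<in>T. \<phi> g x = x)"


section \<open>Polish groups and comeagre conjugacy classes\<close>

locale Polish_group = group G for G (structure) +
  fixes X :: "'a topology"
  assumes topspace_eq: "topspace X = carrier G"
    and continuous_mult: "continuous_map (prod_topology X X) X (\<lambda>(g, h). g \<otimes> h)"
    and continuous_inv: "continuous_map X X (\<lambda>g. inv g)"
    and separable: "separable_space X"
    and completely_metrizable: "completely_metrizable_space X"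

definition comeagre_in :: "'a topology \<Rightarrow> 'a set \<Rightarrow> bool" where
  "comeagre_in X A \<longleftrightarrow> A \<subseteq> topspace X \<and>
     (\<exists>\<U>. countable \<U> \<and> (\<forall>U\<in>\<U>. openin X U \<and> X closure_of U = topspace X) \<and>
          topspace X \<inter> \<Inter>\<U> \<subseteq> A)"

definition conjugacy_class :: "('a, 'b) monoid_scheme \<Rightarrow> 'a \<Rightarrow> 'a set" where
  "conjugacy_class G g = {h \<otimes>\<^bsub>G\<^esub> g \<otimes>\<^bsub>G\<^esub> inv\<^bsub>G\<^esub> h |h. h \<in> carrier G}"

end

theory Submission
  imports Defs
begin

text \<open>
  Countably many right translates of the comeagre class \<open>C\<close> of \<open>c\<close> have a common point (Baire), so
  for any countable family \<open>a\<^sub>i\<close> there is a \<open>z\<close> with all \<open>z a\<^sub>i\<close> in \<open>C\<close>.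

  Suppose \<open>c\<close> is loxodromic and take \<open>x\<close> with \<open>x\<close>, \<open>x c\<^sup>2\<close> and \<open>x c\<^sup>-\<^sup>2\<close> in \<open>C\<close>. For one of the last
  two, a fundamental domain of its axis contains two consecutive fundamental domains of the axis of
  \<open>c\<close>. A conjugating element carries the large domain to some fundamental domain of \<open>c\<close>, which after
  translation along the axis lies inside the two consecutive ones: this is a nesting.

  Suppose \<open>c\<close> is elliptic and write \<open>g = x y\<close> with \<open>x\<close>, \<open>y\<close> elliptic. If their fixed point sets are
  disjoint, let \<open>p\<close>, \<open>q\<close> be the endpoints of the bridge between them. Any element agreeing with \<open>x y\<close>
  at \<open>p\<close> and \<open>q\<close> moves both along a line, hence is loxodromic; in particular, two elliptic elements
  with elliptic product have a common fixed point. Take \<open>z\<close> with \<open>z\<close>, \<open>z x\<close>, \<open>z y\<close> and \<open>z g\<close> in \<open>C\<close>.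
  Then \<open>z\<close> shares a fixed point with \<open>x\<close> and one with \<open>y\<close>, so it fixes the bridge, and \<open>g z\<close>, a
  conjugate of \<open>z g\<close>, agrees with \<open>g\<close> at \<open>p\<close> and \<open>q\<close>: a contradiction.
\<close>

section \<open>Betweenness in a real tree\<close>

context Metric_space
begin

text \<open>Non-strict, and with the intermediate point in the middle, unlike \<open>between\<close>.\<close>

definition btw :: "'a \<Rightarrow> 'a \<Rightarrow> 'a \<Rightarrow> bool" where
  "btw x y z \<longleftrightarrow> x \<in> M \<and> y \<in> M \<and> z \<in> M \<and> d x y + d y z = d x z"

lemma btw_memD: "btw x y z \<Longrightarrow> x \<in> M \<and> y \<in> M \<and> z \<in> M"
  by (simp add: btw_def)

lemma btw_commute: "btw x y z \<Longrightarrow> btw z y x"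
  by (auto simp: btw_def commute)

lemma btw_dist_le: "btw x y z \<Longrightarrow> d x y \<le> d x z"
  using nonneg[of y z] unfolding btw_def by linarith

lemma btw_left [simp]: "x \<in> M \<Longrightarrow> z \<in> M \<Longrightarrow> btw x x z"
  and btw_right [simp]: "x \<in> M \<Longrightarrow> z \<in> M \<Longrightarrow> btw x z z"
  by (auto simp: btw_def)

lemma btw_same: "btw x y x \<Longrightarrow> y = x"
  using nonneg[of x y] by (auto simp: btw_def commute)

lemma btw_trans:
  assumes "btw a b c" "btw a c e"
  shows "btw a b e" "btw b c e"
  using assms triangle[of a b e] triangle[of b c e]
  by (auto simp: btw_def)

lemma btw_trans_right:
  assumes "btw a b e" "btw b c e"
  shows "btw a c e" "btw a b c"
  using btw_trans[of e c b a] assms btw_commute by blast+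

lemma btw_antisym: "btw a b c \<Longrightarrow> btw a c b \<Longrightarrow> b = c"
  by (metis btw_commute btw_trans(2) btw_same)

text \<open>The isometry does not say which parameters the endpoints of the arc have. Comparing it
  with the topological parametrisation puts them at the extremes, so \<open>d x\<close> becomes an
  arc-length coordinate on \<open>A\<close>.\<close>

lemma arc_joiningD:
  assumes "arc_joining x y A" "isometric_to_interval A"
  shows "A \<subseteq> M" "x \<in> A" "y \<in> A"
    and "\<And>w. w \<in> A \<Longrightarrow> btw x w y"
    and "\<And>w w'. w \<in> A \<Longrightarrow> w' \<in> A \<Longrightarrow> d w w' = \<bar>d x w - d x w'\<bar>"
    and "\<And>t. 0 \<le> t \<Longrightarrow> t \<le> d x y \<Longrightarrow> \<exists>w\<in>A. d x w = t"
proof -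
  obtain \<gamma> where emb: "embedding_map (top_of_set {0..1::real}) mtopology \<gamma>"
    and ends: "\<gamma> 0 = x" "\<gamma> 1 = y" and A: "A = \<gamma> ` {0..1}"
    using assms(1) by (auto simp: arc_joining_def)
  obtain J f where J: "f ` J = A"
    and iso: "\<And>s t. s \<in> J \<Longrightarrow> t \<in> J \<Longrightarrow> d (f s) (f t) = \<bar>s - t\<bar>"
    using assms(2) by (auto simp: isometric_to_interval_def)
  have hom: "homeomorphic_map (top_of_set {0..1}) (subtopology mtopology A) \<gamma>"
    using emb A by (simp add: embedding_map_def)
  then have inj: "inj_on \<gamma> {0..1}"
    using homeomorphic_imp_injective_map by fastforce
  have cont: "continuous_map (top_of_set {0..1}) mtopology \<gamma>"
    using hom homeomorphic_imp_continuous_map continuous_map_in_subtopology by blast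
  show AM: "A \<subseteq> M"
    using continuous_map_image_subset_topspace[OF cont] A by simp
  show xA: "x \<in> A" and yA: "y \<in> A"
    using A ends by auto
  \<comment> \<open>The real coordinate of \<open>\<gamma> s\<close> under the isometry. It is
    continuous and injective, hence monotone, possibly decreasing.\<close>
  define k where "k s = (SOME j. j \<in> J \<and> f j = \<gamma> s)" for s
  have k: "k s \<in> J \<and> f (k s) = \<gamma> s" if "s \<in> {0..1}" for s
  proof -
    have "\<gamma> s \<in> f ` J"
      using that A J by blast
    then have "\<exists>j. j \<in> J \<and> f j = \<gamma> s"
      by auto
    then show ?thesis
      unfolding k_def by (rule someI_ex)
  qed
  have dk: "d (\<gamma> s) (\<gamma> t) = \<bar>k s - k t\<bar>" if "s \<in> {0..1}" "t \<in> {0..1}" for s t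
    using iso[of "k s" "k t"] k that by simp
  have injk: "inj_on k {0..1}"
    using inj k unfolding inj_on_def by metis
  have contk: "continuous_on {0..1} k"
    unfolding continuous_on_iff
  proof (intro ballI allI impI)
    fix s e :: real
    assume s: "s \<in> {0..1}" and e: "e > 0"
    then obtain U where U: "openin (top_of_set {0..1}) U" "s \<in> U" "\<forall>t\<in>U. \<gamma> t \<in> mball (\<gamma> s) e"
      using cont unfolding continuous_map_to_metric by (metis topspace_euclidean_subtopology)
    then obtain r where r: "r > 0" "ball s r \<inter> {0..1} \<subseteq> U"
      unfolding openin_contains_ball by blast
    have "dist (k t) (k s) < e" if "t \<in> {0..1}" "dist t s < r" for t
    proof -
      have "t \<in> U"
        using r that by (auto simp: dist_commute)
      then have "d (\<gamma> s) (\<gamma> t) < e"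
        using U by auto
      then show ?thesis
        using dk s that by (simp add: dist_real_def abs_minus_commute)
    qed
    then show "\<exists>r>0. \<forall>t\<in>{0..1}. dist t s < r \<longrightarrow> dist (k t) (k s) < e"
      using r by blast
  qed
  have mono: "k 0 \<le> k s \<and> k s \<le> k 1 \<or> k 1 \<le> k s \<and> k s \<le> k 0" if "s \<in> {0..1}" for s
  proof (cases "s = 0 \<or> s = 1")
    case False
    with that show ?thesis
      using continuous_inj_imp_mono[OF _ _ contk injk, of s] by auto
  qed auto
  show btw: "btw x w y" if w: "w \<in> A" for w
  proof -
    obtain s where s: "s \<in> {0..1}" "w = \<gamma> s"
      using w A by auto
    then have "d x w = \<bar>k 0 - k s\<bar>" "d w y = \<bar>k s - k 1\<bar>" "d x y = \<bar>k 0 - k 1\<bar>"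
      using dk[of 0 s] dk[of s 1] dk[of 0 1] ends by auto
    then show ?thesis
      using mono[OF s(1)] w xA yA AM by (auto simp: btw_def)
  qed
  show "d w w' = \<bar>d x w - d x w'\<bar>" if "w \<in> A" "w' \<in> A" for w w'
  proof -
    obtain s where s: "s \<in> {0..1}" "w = \<gamma> s"
      using \<open>w \<in> A\<close> A by blast
    obtain s' where s': "s' \<in> {0..1}" "w' = \<gamma> s'"
      using \<open>w' \<in> A\<close> A by blast
    have "d x w = \<bar>k 0 - k s\<bar>" "d x w' = \<bar>k 0 - k s'\<bar>" "d w w' = \<bar>k s - k s'\<bar>"
      using dk[of 0 s] dk[of 0 s'] dk[of s s'] ends s s' by auto
    then show ?thesis
      using mono[OF s(1)] mono[OF s'(1)] by linarith
  qed
  show "\<exists>w\<in>A. d x w = t" if t: "0 \<le> t" "t \<le> d x y" for t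
  proof -
    have "continuous_on {0..1} (\<lambda>s. \<bar>k 0 - k s\<bar>)"
      by (intro continuous_intros contk)
    moreover have "\<bar>k 0 - k 1\<bar> = d x y"
      using dk[of 0 1] ends by simp
    ultimately obtain s where "s \<in> {0..1}" "\<bar>k 0 - k s\<bar> = t"
      using IVT'[of "\<lambda>s. \<bar>k 0 - k s\<bar>" 0 t 1] t by auto
    then show ?thesis
      using dk[of 0 s] ends A by auto
  qed
qed

end

context R_tree
begin

section \<open>Segments as unique arcs, and gluing of segments\<close>

lemma segment_arc:
  assumes "x \<in> M" "y \<in> M" "x \<noteq> y"
  shows "arc_joining x y (segment x y)"
  using theI'[OF unique_arc[OF assms]] assms by (simp add: segment_def)

lemma arc_eq_segment:
  assumes "x \<in> M" "y \<in> M" "x \<noteq> y" "arc_joining x y A"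
  shows "A = segment x y"
  using unique_arc[OF assms(1-3)] segment_arc[OF assms(1-3)] assms(4) by blast

lemma segmentD:
  assumes "x \<in> M" "y \<in> M"
  shows "segment x y \<subseteq> M" "x \<in> segment x y" "y \<in> segment x y"
    and "\<And>w. w \<in> segment x y \<Longrightarrow> btw x w y"
    and "\<And>w w'. w \<in> segment x y \<Longrightarrow> w' \<in> segment x y \<Longrightarrow> d w w' = \<bar>d x w - d x w'\<bar>"
    and "\<And>t. 0 \<le> t \<Longrightarrow> t \<le> d x y \<Longrightarrow> \<exists>w\<in>segment x y. d x w = t"
proof -
  have "segment x y \<subseteq> M \<and> x \<in> segment x y \<and> y \<in> segment x y
    \<and> (\<forall>w\<in>segment x y. btw x w y)
    \<and> (\<forall>w\<in>segment x y. \<forall>w'\<in>segment x y. d w w' = \<bar>d x w - d x w'\<bar>)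
    \<and> (\<forall>t. 0 \<le> t \<and> t \<le> d x y \<longrightarrow> (\<exists>w\<in>segment x y. d x w = t))"
  proof (cases "x = y")
    case True
    then show ?thesis
      using assms by (auto simp: segment_def)
  next
    case False
    note arc = segment_arc[OF assms False]
    from arc_joiningD[OF arc arc_isometric[OF assms False arc]]
    show ?thesis by blast
  qed
  then show "segment x y \<subseteq> M" "x \<in> segment x y" "y \<in> segment x y"
    and "\<And>w. w \<in> segment x y \<Longrightarrow> btw x w y"
    and "\<And>w w'. w \<in> segment x y \<Longrightarrow> w' \<in> segment x y \<Longrightarrow> d w w' = \<bar>d x w - d x w'\<bar>"
    and "\<And>t. 0 \<le> t \<Longrightarrow> t \<le> d x y \<Longrightarrow> \<exists>w\<in>segment x y. d x w = t"
    by blast+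
qed

text \<open>Both segments are traversed in turn at unit speed. The path is 1-Lipschitz and injective
  on a compact interval, hence an embedding; that it is isometric follows only later, from
  uniqueness of arcs.\<close>

lemma arc_concatenate:
  assumes M: "x \<in> M" "y \<in> M" "z \<in> M" and "x \<noteq> y"
    and meet: "\<And>w. btw x w y \<Longrightarrow> btw y w z \<Longrightarrow> w = y"
  shows "\<exists>A. arc_joining x z A \<and> y \<in> A"
proof -
  define l where "l = d x y"
  define L where "L = d x y + d y z"
  have pos: "0 < l" "l \<le> L" "0 < L"
    using M \<open>x \<noteq> y\<close> by (simp_all add: l_def L_def add_pos_nonneg)
  obtain h where h: "\<And>t. 0 \<le> t \<Longrightarrow> t \<le> l \<Longrightarrow> h t \<in> segment x y \<and> d x (h t) = t"
    using segmentD(6)[OF M(1,2)] unfolding l_def by metis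
  obtain k where k: "\<And>t. 0 \<le> t \<Longrightarrow> t \<le> L - l \<Longrightarrow> k t \<in> segment y z \<and> d y (k t) = t"
    using segmentD(6)[OF M(2,3)] unfolding l_def L_def by (metis add_diff_cancel_left')
  define \<gamma> where "\<gamma> t = (if t \<le> l then h t else k (t - l))" for t
  have hM: "h t \<in> M" and hb: "btw x (h t) y" if "0 \<le> t" "t \<le> l" for t
    using h[OF that] segmentD(1,4)[OF M(1,2)] by auto
  have kM: "k t \<in> M" and kb: "btw y (k t) z" if "0 \<le> t" "t \<le> L - l" for t
    using k[OF that] segmentD(1,4)[OF M(2,3)] by auto
  have dh: "d (h s) (h t) = \<bar>s - t\<bar>" if "0 \<le> s" "s \<le> l" "0 \<le> t" "t \<le> l" for s t
    using segmentD(5)[OF M(1,2), of "h s" "h t"] h that by auto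
  have dk: "d (k s) (k t) = \<bar>s - t\<bar>" if "0 \<le> s" "s \<le> L - l" "0 \<le> t" "t \<le> L - l" for s t
    using segmentD(5)[OF M(2,3), of "k s" "k t"] k that by auto
  have dhy: "d (h s) y = l - s" if "0 \<le> s" "s \<le> l" for s
    using hb[OF that] h[OF that] by (auto simp: btw_def l_def)
  have hl: "h l = y"
    using dhy[of l] hM[of l] pos M zero by auto
  have \<gamma>M: "\<gamma> t \<in> M" if "0 \<le> t" "t \<le> L" for t
    using that hM kM by (auto simp: \<gamma>_def)
  have lip: "d (\<gamma> s) (\<gamma> t) \<le> \<bar>s - t\<bar>" if s: "0 \<le> s" "s \<le> L" and t: "0 \<le> t" "t \<le> L" for s t
  proof -
    have mixed: "d (\<gamma> s) (\<gamma> t) \<le> \<bar>s - t\<bar>" if "0 \<le> s" "s \<le> l" "l < t" "t \<le> L" for s t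
    proof -
      have "d (h s) (k (t - l)) \<le> d (h s) y + d y (k (t - l))"
        using triangle hM kM M that by simp
      then show ?thesis
        using that dhy[of s] k[of "t - l"] by (simp add: \<gamma>_def)
    qed
    consider "s \<le> l" "t \<le> l" | "s \<le> l" "l < t" | "l < s" "t \<le> l" | "l < s" "l < t"
      by linarith
    then show ?thesis
    proof cases
      case 3
      then show ?thesis
        using mixed[of t s] s t by (simp add: commute abs_minus_commute)
    qed (use mixed[of s t] dh dk s t in \<open>auto simp: \<gamma>_def\<close>)
  qed
  have inj: "s = t" if s: "0 \<le> s" "s \<le> L" and t: "0 \<le> t" "t \<le> L" and eq: "\<gamma> s = \<gamma> t" for s t
  proof -
    have mixed: False if "0 \<le> s" "s \<le> l" "l < t" "t \<le> L" "\<gamma> s = \<gamma> t" for s t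
    proof -
      have eq: "h s = k (t - l)"
        using that by (simp add: \<gamma>_def)
      then have "h s = y"
        using hb[of s] kb[of "t - l"] meet that by auto
      then have "d y (k (t - l)) = 0"
        using eq M by simp
      then show False
        using k[of "t - l"] that by auto
    qed
    consider "s \<le> l" "t \<le> l" | "s \<le> l" "l < t" | "l < s" "t \<le> l" | "l < s" "l < t"
      by linarith
    then show ?thesis
    proof cases
      case 1
      then have "h s = h t"
        using eq by (simp add: \<gamma>_def)
      then show ?thesis
        using h[of s] h[of t] s t 1 by metis
    next
      case 4
      then have "k (s - l) = k (t - l)"
        using eq by (simp add: \<gamma>_def)
      moreover have "d y (k (s - l)) = s - l" "d y (k (t - l)) = t - l"
        using k s t 4 by simp_all
      ultimately have "s - l = t - l"
        by metis
      then show ?thesis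
        by simp
    next
      case 2
      from mixed[OF s(1) this t(2) eq] show ?thesis ..
    next
      case 3
      from mixed[OF t(1) this(2,1) s(2) eq[symmetric]] show ?thesis ..
    qed
  qed
  define \<delta> where "\<delta> s = \<gamma> (s * L)" for s
  have range: "0 \<le> s * L \<and> s * L \<le> L" if "s \<in> {0..1}" for s
    using that pos by (auto simp: mult_left_le_one_le)
  have "continuous_map (top_of_set {0..1}) mtopology \<delta>"
    unfolding continuous_map_to_metric
  proof (intro ballI allI impI)
    fix s e :: real
    assume s: "s \<in> topspace (top_of_set {0..1})" and "e > 0"
    have "\<delta> t \<in> mball (\<delta> s) e" if t: "t \<in> ball s (e / L) \<inter> {0..1}" for t
    proof -
      have "d (\<delta> s) (\<delta> t) \<le> \<bar>s * L - t * L\<bar>"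
        unfolding \<delta>_def by (rule lip) (use range s t in auto)
      also have "\<dots> = \<bar>s - t\<bar> * L"
        using pos by (simp add: abs_mult flip: left_diff_distrib)
      also have "\<dots> < e"
        using t pos by (simp add: dist_real_def field_simps)
      finally show ?thesis
        using \<gamma>M range s t by (auto simp: \<delta>_def)
    qed
    then show "\<exists>U. openin (top_of_set {0..1}) U \<and> s \<in> U \<and> (\<forall>t\<in>U. \<delta> t \<in> mball (\<delta> s) e)"
      using s pos \<open>e > 0\<close>
      by (intro exI[of _ "ball s (e / L) \<inter> {0..1}"]) (auto simp: openin_open)
  qed
  moreover have "inj_on \<delta> {0..1}"
    unfolding inj_on_def \<delta>_def using inj range pos
    by (metis less_irrefl mult_right_cancel)
  ultimately have "embedding_map (top_of_set {0..1}) mtopology \<delta>"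
    by (intro continuous_imp_embedding_map)
      (auto simp: Hausdorff_space_mtopology compact_space_subtopology)
  moreover have "\<delta> 0 = x"
    using h[of 0] pos hM[of 0] M zero by (auto simp: \<delta>_def \<gamma>_def)
  moreover have "\<delta> 1 = z"
  \<comment> \<open>If \<open>L = l\<close>, the second branch of \<open>\<gamma>\<close> is never
    reached.\<close>
  proof (cases "L = l")
    case True
    then have "y = z"
      using M by (auto simp: L_def l_def)
    then show ?thesis
      using True hl by (simp add: \<delta>_def \<gamma>_def)
  next
    case False
    then have "d (k (L - l)) z = 0"
      using kb[of "L - l"] k[of "L - l"] pos by (auto simp: btw_def L_def l_def)
    then show ?thesis
      using False pos kM[of "L - l"] M by (auto simp: \<delta>_def \<gamma>_def)
  qed
  moreover have "y \<in> \<delta> ` {0..1}"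
    using pos hl by (intro image_eqI[of _ _ "l / L"]) (auto simp: \<delta>_def \<gamma>_def)
  ultimately show ?thesis
    unfolding arc_joining_def by blast
qed

text \<open>By uniqueness the glued arc is the segment from \<open>x\<close> to \<open>z\<close>,
  and the isometry axiom for that segment yields additivity of distances at
  \<open>y\<close>.\<close>

lemma btw_concatenate:
  assumes M: "x \<in> M" "y \<in> M" "z \<in> M"
    and meet: "\<And>w. btw x w y \<Longrightarrow> btw y w z \<Longrightarrow> w = y"
  shows "btw x y z \<and> y \<in> segment x z"
proof (cases "x = y")
  case True
  then show ?thesis
    using M segmentD(2) by simp
next
  case False
  with arc_concatenate[OF M] meet obtain A where A: "arc_joining x z A" "y \<in> A"
    by blast
  have "x \<noteq> z"
    using meet[of x] M False by auto
  then have "y \<in> segment x z"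
    using arc_eq_segment[OF M(1,3) _ A(1)] A(2) by simp
  then show ?thesis
    using segmentD(4)[OF M(1,3)] by simp
qed

text \<open>Translates the arc-based definitions into \<open>btw\<close>. By the triangle inequality
  the pieces on either side of \<open>u\<close> meet only in \<open>u\<close>, so they glue.\<close>

lemma mem_segment_iff:
  assumes "x \<in> M" "y \<in> M"
  shows "u \<in> segment x y \<longleftrightarrow> btw x u y"
proof
  assume u: "btw x u y"
  have "w = u" if "btw x w u" "btw u w y" for w
  proof -
    have "d u w \<le> 0"
      using that u triangle[of x w y] by (auto simp: btw_def commute)
    then show ?thesis
      using that by (metis antisym btw_memD nonneg zero)
  qed
  then show "u \<in> segment x y"
    using btw_concatenate[of x u y] u by (auto simp: btw_def)
qed (rule segmentD(4)[OF assms])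

lemma btw_dist:
  assumes "btw x u y" "btw x v y"
  shows "d u v = \<bar>d x u - d x v\<bar>"
  using segmentD(5) assms btw_memD mem_segment_iff by metis

lemma btw_exists_dist:
  assumes "x \<in> M" "y \<in> M" "0 \<le> t" "t \<le> d x y"
  shows "\<exists>w. btw x w y \<and> d x w = t"
  using segmentD(6)[OF assms] segmentD(4)[OF assms(1,2)] by blast

lemma btw_order:
  assumes "btw x u y" "btw x v y"
  shows "btw x u v \<longleftrightarrow> d x u \<le> d x v"
proof
  show "btw x u v" if "d x u \<le> d x v"
    using btw_dist[OF assms] assms that by (auto simp: btw_def)
qed (rule btw_dist_le)

lemma btw_linear:
  assumes "btw x u y" "btw x v y"
  shows "btw x u v \<or> btw x v u"
  using btw_order assms by (meson linorder_linear)

text \<open>Special to trees; on a circle with arc-length metric it fails. The paths from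
  \<open>c\<close> to \<open>a\<close> and from \<open>c\<close> to \<open>e\<close> share no
  further point, since the first begins with the nondegenerate piece to \<open>b\<close>.\<close>

lemma btw_glue:
  assumes "btw a b c" "btw b c e" "b \<noteq> c"
  shows "btw a c e" "btw a b e"
proof -
  note M = btw_memD[OF assms(1)] btw_memD[OF assms(2)]
  have "w = c" if w: "btw a w c" "btw c w e" for w
  proof -
    from btw_linear[OF btw_commute[OF assms(1)] btw_commute[OF w(1)]]
    consider "btw c w b" | "btw c b w" by blast
    then show ?thesis
    proof cases
      case 1
      then show ?thesis
        by (meson assms(2) btw_antisym btw_commute btw_trans w(2) btw_same)
    next
      case 2
      then show ?thesis
        by (metis assms(2,3) btw_antisym btw_commute btw_trans w(2))
    qed
  qed
  then show "btw a c e"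
    using btw_concatenate[of a c e] M by blast
  then show "btw a b e"
    using btw_trans assms(1) by blast
qed

section \<open>Suprema and medians\<close>

text \<open>The supremum is phrased with \<open>btw\<close> because weak homeomorphisms preserve
  betweenness but not distances.\<close>

lemma btw_sup:
  assumes M: "p \<in> M" "q \<in> M" and S: "\<And>u. u \<in> S \<Longrightarrow> btw p u q"
  obtains s where "btw p s q" "\<And>u. u \<in> S \<Longrightarrow> btw p u s"
    and "\<And>t. btw p t q \<Longrightarrow> (\<And>u. u \<in> S \<Longrightarrow> btw p u t) \<Longrightarrow> btw p s t"
proof (cases "S = {}")
  case True
  then show ?thesis
    using M btw_memD by (intro that[of p]) auto
next
  case False
  let ?D = "d p ` S"
  have bdd: "bdd_above ?D"
    using S btw_dist_le by (auto intro!: bdd_aboveI)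
  have "Sup ?D \<le> d p q"
    using False S btw_dist_le by (intro cSup_least) auto
  moreover have "0 \<le> Sup ?D"
    using False bdd nonneg by (meson cSup_upper2 ex_in_conv imageI)
  ultimately obtain s where s: "btw p s q" "d p s = Sup ?D"
    using btw_exists_dist[OF M] by blast
  show ?thesis
  proof (rule that[OF s(1)])
    show "btw p u s" if "u \<in> S" for u
      using btw_order[OF S[OF that] s(1)] s(2) cSup_upper[OF _ bdd] that by simp
    show "btw p s t" if t: "btw p t q" and ub: "\<And>u. u \<in> S \<Longrightarrow> btw p u t" for t
    proof -
      have "Sup ?D \<le> d p t"
        using False ub btw_order[OF S t] by (intro cSup_least) auto
      then show ?thesis
        using btw_order[OF s(1) t] s(2) by simp
    qed
  qed
qed

lemma btw_dense:
  assumes "p \<in> M" "q \<in> M" "p \<noteq> q"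
  obtains v where "btw p v q" "v \<noteq> p" "v \<noteq> q"
proof -
  have pos: "0 < d p q"
    using assms by simp
  then obtain v where v: "btw p v q" "d p v = d p q / 2"
    using btw_exists_dist[OF assms(1,2), of "d p q / 2"] by auto
  moreover have "v \<noteq> p" "v \<noteq> q"
    using v pos assms by auto
  ultimately show thesis
    using that by blast
qed

text \<open>The median is the last point \<open>s\<close> on the path from \<open>y\<close> to
  \<open>x\<close> that is also on the path from \<open>y\<close> to \<open>z\<close>. Beyond
  \<open>s\<close> the paths part, so they glue there.\<close>

lemma median_exists:
  assumes M: "x \<in> M" "y \<in> M" "z \<in> M"
  obtains m where "btw x m y" "btw y m z" "btw x m z"
proof -
  define S where "S = {u. btw y u x \<and> btw y u z}"
  obtain s where s: "btw y s x" "\<And>u. u \<in> S \<Longrightarrow> btw y u s"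
      "\<And>t. btw y t x \<Longrightarrow> (\<And>u. u \<in> S \<Longrightarrow> btw y u t) \<Longrightarrow> btw y s t"
    using btw_sup[OF M(2,1), of S] by (auto simp: S_def)
  have "y \<in> S"
    using M by (simp add: S_def)
  have le: "d y u \<le> d y s" if "u \<in> S" for u
    using s(2)[OF that] by (rule btw_dist_le)
  \<comment> \<open>A gap below \<open>s\<close> would contain a smaller upper bound of
    \<open>S\<close>.\<close>
  have approx: "\<exists>u\<in>S. d y s - e < d y u" if e: "e > 0" for e
  proof (rule ccontr)
    assume "\<not> ?thesis"
    then have far: "\<And>u. u \<in> S \<Longrightarrow> d y u \<le> d y s - e"
      by force
    with \<open>y \<in> S\<close> have "0 \<le> d y s - e"
      using M by force
    then obtain t where t: "btw y t s" "d y t = d y s - e"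
      using btw_exists_dist[of y s "d y s - e"] e s(1) btw_memD by force
    have tx: "btw y t x"
      using btw_trans t(1) s(1) by blast
    have "btw y u t" if "u \<in> S" for u
      using btw_order[of y u x t] far[OF that] t tx that by (simp add: S_def)
    then have "btw y s t"
      using s(3) tx by blast
    then show False
      using t e btw_dist_le by fastforce
  qed
  have sM: "s \<in> M"
    using s(1) btw_memD by blast
  have dsz: "d y s \<le> d y z"
  proof (rule field_le_epsilon)
    fix e :: real assume "e > 0"
    then obtain u where "u \<in> S" "d y s - e < d y u"
      using approx by blast
    then show "d y s \<le> d y z + e"
      using btw_dist_le[of y u z] by (simp add: S_def)
  qed
  \<comment> \<open>The candidate for \<open>s\<close> on the path to \<open>z\<close>. Points of
    \<open>S\<close> come arbitrarily close to both, so they coincide.\<close>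
  then obtain s' where s': "btw y s' z" "d y s' = d y s"
    using btw_exists_dist[of y z "d y s"] M nonneg by blast
  have s'M: "s' \<in> M"
    using s' btw_memD by blast
  have "d s s' \<le> 0"
  proof (rule field_le_epsilon)
    fix e :: real assume "e > 0"
    then obtain u where u: "u \<in> S" "d y s - e / 2 < d y u"
      using approx[of "e / 2"] by auto
    then have "d s u = \<bar>d y s - d y u\<bar>" "d u s' = \<bar>d y u - d y s'\<bar>" "u \<in> M"
      using btw_dist s(1) s'(1) btw_memD unfolding S_def by blast+
    moreover have "d s s' \<le> d s u + d u s'"
      using triangle sM s'M \<open>u \<in> M\<close> by simp
    ultimately show "d s s' \<le> 0 + e"
      using le[OF u(1)] u(2) s'(2) by linarith
  qed
  then have "s = s'"
    using sM s'M by (metis antisym nonneg zero)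
  then have sz: "btw y s z"
    using s' by simp
  have "w = s" if w: "btw x w s" "btw s w z" for w
  proof -
    have "btw y s w" "btw y w x"
      using w(1) s(1) btw_commute btw_trans by meson+
    moreover have "btw y w z"
      using w(2) sz btw_commute btw_trans by meson
    ultimately show ?thesis
      using s(2)[of w] btw_antisym unfolding S_def by blast
  qed
  then have "btw x s z"
    using btw_concatenate[of x s z] M sM by blast
  then show thesis
    using that[of s] s(1) sz btw_commute by blast
qed

text \<open>Lets a median serve as an upper bound: what precedes both \<open>s\<close> and
  \<open>t\<close> precedes the point where their paths part. The later supremum arguments rest on
  this instead of continuity.\<close>

lemma btw_median:
  assumes m: "btw a m s" "btw a m t" "btw s m t" and u: "btw a u s" "btw a u t"
  shows "btw a u m"
  using btw_linear[OF m(1) u(1)] by (metis assms btw_antisym btw_commute btw_trans)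

end

section \<open>Non-nesting actions\<close>

locale non_nesting_action = R_tree_action +
  assumes non_nesting: "non_nesting G \<phi>"
begin

sublocale group G
  using group_hom by (simp add: group_hom_def)

lemma act_mem [simp]: "g \<in> carrier G \<Longrightarrow> x \<in> M \<Longrightarrow> \<phi> g x \<in> M"
  using element_image by blast

lemma act_mult [simp]:
  "g \<in> carrier G \<Longrightarrow> h \<in> carrier G \<Longrightarrow> x \<in> M \<Longrightarrow> \<phi> (g \<otimes> h) x = \<phi> g (\<phi> h x)"
  by (rule composition_rule)

lemma act_one [simp]: "x \<in> M \<Longrightarrow> \<phi> \<one> x = x"
  by (metis id_eq_one restrict_apply)

lemma act_inv [simp]:
  assumes "g \<in> carrier G" "x \<in> M"
  shows "\<phi> (inv g) (\<phi> g x) = x" "\<phi> g (\<phi> (inv g) x) = x"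
  using assms act_mult[of "inv g" g x] act_mult[of g "inv g" x] by auto

lemma act_eq_iff [simp]:
  "g \<in> carrier G \<Longrightarrow> x \<in> M \<Longrightarrow> y \<in> M \<Longrightarrow> \<phi> g x = \<phi> g y \<longleftrightarrow> x = y"
  by (metis act_inv(1))

lemma between_iff:
  assumes "x \<in> M" "y \<in> M" "z \<in> M"
  shows "between x y z \<longleftrightarrow> btw y x z \<and> x \<noteq> y \<and> x \<noteq> z"
  using mem_segment_iff assms by (auto simp: between_def open_seg_def)

lemma act_btw:
  assumes "g \<in> carrier G" "btw x y z"
  shows "btw (\<phi> g x) (\<phi> g y) (\<phi> g z)"
proof (cases "y = x \<or> y = z")
  case True
  then show ?thesis
    using assms btw_memD[OF assms(2)] by auto
next
  case False
  note M = btw_memD[OF assms(2)]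
  then have "between y x z"
    using False assms(2) between_iff by simp
  then have "between (\<phi> g y) (\<phi> g x) (\<phi> g z)"
    using weak_homeo[OF assms(1)] M by (simp add: weak_homeomorphism_def)
  then show ?thesis
    using between_iff M assms(1) by simp
qed

lemma act_btw_inv:
  assumes "g \<in> carrier G" "x \<in> M" "y \<in> M" "z \<in> M" "btw (\<phi> g x) (\<phi> g y) (\<phi> g z)"
  shows "btw x y z"
  using act_btw[of "inv g", OF _ assms(5)] assms by simp

lemma fixes_inv:
  "g \<in> carrier G \<Longrightarrow> x \<in> M \<Longrightarrow> \<phi> g x = x \<Longrightarrow> \<phi> (inv g) x = x"
  by (metis act_inv(1))

lemma act_segment:
  assumes "g \<in> carrier G" "x \<in> M" "y \<in> M"
  shows "\<phi> g ` segment x y = segment (\<phi> g x) (\<phi> g y)"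
proof (intro subset_antisym subsetI)
  fix v assume "v \<in> segment (\<phi> g x) (\<phi> g y)"
  then have v: "btw (\<phi> g x) v (\<phi> g y)"
    using assms mem_segment_iff by simp
  then have "btw x (\<phi> (inv g) v) y"
    using act_btw[of "inv g", OF _ v] assms by simp
  then show "v \<in> \<phi> g ` segment x y"
    using assms mem_segment_iff btw_memD[OF v] by (intro image_eqI[of _ _ "\<phi> (inv g) v"]) simp_all
qed (use assms mem_segment_iff act_btw in auto)

text \<open>Non-nesting in the form used from here on: the image segment lies in the original one,
  so the two are equal and \<open>g\<close> permutes the endpoints.\<close>

lemma segment_nested:
  assumes g: "g \<in> carrier G" and x: "btw x (\<phi> g x) y" and y: "btw x (\<phi> g y) y"
  shows "\<phi> g x = x \<and> \<phi> g y = y \<or> \<phi> g x = y \<and> \<phi> g y = x"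
proof -
  note M = btw_memD[OF x]
  have "segment (\<phi> g x) (\<phi> g y) \<subseteq> segment x y"
  proof
    fix u assume "u \<in> segment (\<phi> g x) (\<phi> g y)"
    then have u: "btw (\<phi> g x) u (\<phi> g y)"
      using M g mem_segment_iff by simp
    have "btw x u y"
      using btw_linear[OF x y] u x y by (meson btw_commute btw_trans btw_trans_right)
    then show "u \<in> segment x y"
      using M mem_segment_iff by simp
  qed
  moreover have "\<not> \<phi> g ` segment x y \<subset> segment x y"
    using non_nesting g M unfolding non_nesting_def is_segment_def by blast
  ultimately have "segment (\<phi> g x) (\<phi> g y) = segment x y"
    using act_segment g M by blast
  then have "btw (\<phi> g x) x (\<phi> g y)" "btw (\<phi> g x) y (\<phi> g y)"
    using M g mem_segment_iff segmentD(2,3) act_mem by metis+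
  with btw_linear[OF x y] show ?thesis
    using x y by (metis btw_antisym btw_commute btw_trans)
qed

section \<open>Fixed points\<close>

text \<open>The longer of the segments from \<open>a\<close> to \<open>s\<close> and to
  \<open>\<phi> g s\<close> is mapped into itself by \<open>inv g\<close> or \<open>g\<close>.
  Swapping its ends would move \<open>a\<close>, unless the segment is a point.\<close>

lemma fixes_of_btw:
  assumes g: "g \<in> carrier G" and a: "\<phi> g a = a" and s: "btw a s (\<phi> g s) \<or> btw a (\<phi> g s) s" "s \<in> M"
  shows "\<phi> g s = s"
  using s(1)
proof
  assume *: "btw a s (\<phi> g s)"
  note M = btw_memD[OF *]
  then show ?thesis
    using segment_nested[of "inv g" a "\<phi> g s"] * g a s(2) fixes_inv[OF g _ a] by auto
next
  assume *: "btw a (\<phi> g s) s"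
  note M = btw_memD[OF *]
  then show ?thesis
    using segment_nested[of g a s] * g a by auto
qed

lemma fixes_between:
  assumes g: "g \<in> carrier G" and a: "\<phi> g a = a" and b: "\<phi> g b = b" and u: "btw a u b"
  shows "\<phi> g u = u"
proof -
  have "btw a (\<phi> g u) b"
    using act_btw[OF g u] a b by simp
  from btw_linear[OF u this] show ?thesis
    using fixes_of_btw[OF g a] u btw_memD by blast
qed

text \<open>The supremum \<open>s\<close> of the fixed points is fixed: the median of
  \<open>a\<close>, \<open>s\<close>, \<open>\<phi> g s\<close> bounds them all, so it equals
  \<open>s\<close>, and \<open>s\<close> lies between \<open>a\<close> and its own image.\<close>

lemma last_fixed_point:
  assumes g: "g \<in> carrier G" and a: "\<phi> g a = a" and M: "a \<in> M" "b \<in> M"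
  obtains p where "btw a p b" "\<phi> g p = p" "\<And>u. btw p u b \<Longrightarrow> \<phi> g u = u \<Longrightarrow> u = p"
proof -
  define S where "S = {u. btw a u b \<and> \<phi> g u = u}"
  obtain s where s: "btw a s b" "\<And>u. u \<in> S \<Longrightarrow> btw a u s"
      "\<And>t. btw a t b \<Longrightarrow> (\<And>u. u \<in> S \<Longrightarrow> btw a u t) \<Longrightarrow> btw a s t"
    using btw_sup[OF M, of S] by (auto simp: S_def)
  have sM: "s \<in> M"
    using s(1) btw_memD by blast
  obtain m where m: "btw a m s" "btw s m (\<phi> g s)" "btw a m (\<phi> g s)"
    using median_exists[of a s "\<phi> g s"] M sM g by auto
  have "btw a u m" if "u \<in> S" for u
  proof -
    have "btw a u (\<phi> g s)"
      using act_btw[OF g s(2)[OF that]] a that by (simp add: S_def)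
    then show ?thesis
      using btw_median m s(2)[OF that] by blast
  qed
  then have "btw a s m"
    using s(3) m(1) s(1) btw_trans by blast
  then have "m = s"
    using m(1) btw_antisym by blast
  then have fx: "\<phi> g s = s"
    using fixes_of_btw[OF g a] m(3) sM by blast
  have "u = s" if "btw s u b" "\<phi> g u = u" for u
  proof -
    have "btw a u b" "btw a s u"
      using that(1) s(1) btw_trans_right by blast+
    then show ?thesis
      using s(2)[of u] that(2) btw_antisym unfolding S_def by blast
  qed
  then show thesis
    using that s(1) fx by blast
qed

text \<open>If the paths from \<open>q\<close> to \<open>p\<close> and to \<open>\<phi> g p\<close>
  shared more than \<open>q\<close>, the branching point and its preimage would be comparable on the
  path to \<open>p\<close>, giving a second fixed point there.\<close>

lemma act_aligned:
  assumes g: "g \<in> carrier G" and q: "\<phi> g q = q" and M: "p \<in> M" "q \<in> M"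
    and only: "\<And>u. btw q u p \<Longrightarrow> \<phi> g u = u \<Longrightarrow> u = q"
  shows "btw p q (\<phi> g p)"
proof -
  obtain m where m: "btw q m p" "btw p m (\<phi> g p)" "btw q m (\<phi> g p)"
    using median_exists[of q p "\<phi> g p"] M g by auto
  note mM = btw_memD[OF m(1)]
  define m' where "m' = \<phi> (inv g) m"
  have m': "btw q m' p" "\<phi> g m' = m" "m' \<in> M"
    using act_btw[of "inv g", OF _ m(3)] g mM fixes_inv[OF g _ q] by (simp_all add: m'_def)
  have "\<phi> g m' = m'"
    using fixes_of_btw[OF g q, of m'] btw_linear[OF m(1) m'(1)] m' by auto
  then have "m = q"
    using only[OF m(1)] m'(2) by simp
  then show ?thesis
    using m(2) by simp
qed

text \<open>Seen from a fixed point \<open>r\<close>, either \<open>p\<close> or \<open>q\<close>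
  would lie on one path with its image and so be fixed by \<open>fixes_of_btw\<close>. Which one
  depends on where \<open>r\<close> projects to the piece from \<open>q\<close> to
  \<open>p\<close>.\<close>

lemma moves_along_line:
  assumes w: "w \<in> carrier G" and qp: "btw q p (\<phi> w q)" "btw p (\<phi> w q) (\<phi> w p)"
    and ne: "p \<noteq> q" "p \<noteq> \<phi> w q" and r: "r \<in> M"
  shows "\<phi> w r \<noteq> r"
proof
  assume fx: "\<phi> w r = r"
  note M = btw_memD[OF qp(1)]
  obtain m where m: "btw q m p" "btw p m r" "btw q m r"
    using median_exists[of q p r] M r by auto
  show False
  proof (cases "m = p")
    case True
    then have "btw (\<phi> w q) (\<phi> w p) r"
      using act_btw[OF w m(3)] fx by simp
    moreover have "\<phi> w q \<noteq> \<phi> w p"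
      using ne(1) M w by auto
    ultimately have "btw p (\<phi> w p) r"
      using btw_glue qp(2) by blast
    then have "\<phi> w p = p"
      using fixes_of_btw[OF w fx, of p] M btw_commute by blast
    then show False
      using qp(2) btw_same ne(2) by metis
  next
    case False
    have "btw m p (\<phi> w q)"
      using m(1) qp(1) btw_trans by blast
    then have "btw r p (\<phi> w q)"
      using btw_glue btw_commute[OF m(2)] False by blast
    then have "btw r (\<phi> w q) (\<phi> w p)" and rp: "btw r p (\<phi> w q)"
      using btw_glue qp(2) ne(2) by blast+
    then have "btw r q p"
      using act_btw_inv[of w r q p] fx w r M by simp
    then have "btw r q (\<phi> w q)"
      using rp btw_trans by blast
    then have "\<phi> w q = q"
      using fixes_of_btw[OF w fx, of q] M by blast
    then show False
      using qp(1) btw_same ne(1) by metis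
  qed
qed

section \<open>Bridges and products of elliptic elements\<close>

abbreviation ell where
  "ell g \<equiv> elliptic M \<phi> g"

text \<open>The witnesses \<open>p\<close> and \<open>q\<close> are the endpoints of the bridge between the fixed point sets of
  \<open>x\<close> and \<open>y\<close>.\<close>

lemma bridge:
  assumes x: "x \<in> carrier G" "ell x" and y: "y \<in> carrier G" "ell y"
    and disj: "\<nexists>u. u \<in> M \<and> \<phi> x u = u \<and> \<phi> y u = u"
  obtains p q where "p \<in> M" "q \<in> M"
    and "\<And>z a b. z \<in> carrier G \<Longrightarrow> a \<in> M \<Longrightarrow> b \<in> M \<Longrightarrow> \<phi> x a = a \<Longrightarrow> \<phi> y b = b \<Longrightarrow>
      \<phi> z a = a \<Longrightarrow> \<phi> z b = b \<Longrightarrow> \<phi> z p = p \<and> \<phi> z q = q"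
    and "\<And>w. w \<in> carrier G \<Longrightarrow> \<phi> w p = \<phi> (x \<otimes> y) p \<Longrightarrow> \<phi> w q = \<phi> (x \<otimes> y) q \<Longrightarrow> \<not> ell w"
proof -
  obtain a b where ab: "a \<in> M" "\<phi> x a = a" "b \<in> M" "\<phi> y b = b"
    using x y by (auto simp: elliptic_def)
  \<comment> \<open>\<open>p\<close> is the last fixed point of \<open>x\<close> on the way to
    \<open>b\<close>, then \<open>q\<close> the last one of \<open>y\<close> on the way to
    \<open>p\<close>; the path between them meets each fixed point set only at its end.\<close>
  obtain p where p: "btw a p b" "\<phi> x p = p" "\<And>u. btw p u b \<Longrightarrow> \<phi> x u = u \<Longrightarrow> u = p"
    using last_fixed_point[OF x(1) ab(2,1,3)] by blast
  have pM: "p \<in> M"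
    using p btw_memD by blast
  obtain q where q: "btw b q p" "\<phi> y q = q" "\<And>u. btw q u p \<Longrightarrow> \<phi> y u = u \<Longrightarrow> u = q"
    using last_fixed_point[OF y(1) ab(4,3) pM] by blast
  have qM: "q \<in> M"
    using q btw_memD by blast
  have onlyx: "u = p" if "btw p u q" "\<phi> x u = u" for u
    using p(3) that q(1) btw_commute btw_trans by metis
  have ne: "p \<noteq> q"
    using disj pM p(2) q(2) by blast
  have xq: "btw q p (\<phi> x q)"
    using act_aligned[OF x(1) p(2) qM pM] onlyx by blast
  have "btw p q (\<phi> y p)"
    using act_aligned[OF y(1) q(2) pM qM] q(3) by blast
  \<comment> \<open>Since \<open>y\<close> fixes \<open>q\<close>, the points \<open>q\<close>,
    \<open>p\<close> and their images under \<open>x \<otimes> y\<close> lie in this order on a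
    line.\<close>
  then have yp: "btw p (\<phi> x q) (\<phi> x (\<phi> y p))"
    using act_btw[OF x(1)] p(2) by metis
  have "p \<noteq> \<phi> x q"
    using ne p(2) act_eq_iff[OF x(1) pM qM] by simp
  then have not_ell: "\<not> ell w" if "w \<in> carrier G" "\<phi> w p = \<phi> (x \<otimes> y) p" "\<phi> w q = \<phi> (x \<otimes> y) q" for w
    using moves_along_line[of w q p] that xq yp ne x y pM qM q(2) by (auto simp: elliptic_def)
  \<comment> \<open>Every path from a fixed point of \<open>x\<close> to one of \<open>y\<close>
    runs through \<open>p\<close> and \<open>q\<close>.\<close>
  have "\<phi> z p = p \<and> \<phi> z q = q"
    if z: "z \<in> carrier G" and M: "a \<in> M" "b \<in> M" and fx: "\<phi> x a = a" "\<phi> y b = b" "\<phi> z a = a" "\<phi> z b = b"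
    for z a b
  proof -
    obtain m where m: "btw a m p" "btw p m q" "btw a m q"
      using median_exists[of a p q] M pM qM by auto
    have "m = p"
      using onlyx[OF m(2)] fixes_between[OF x(1) fx(1) p(2) m(1)] by blast
    then have apq: "btw a p q"
      using m(3) by simp
    obtain m where m: "btw b m q" "btw q m p" "btw b m p"
      using median_exists[of b q p] M pM qM by auto
    have "m = q"
      using q(3)[OF m(2)] fixes_between[OF y(1) fx(2) q(2) m(1)] by blast
    then have "btw p q b"
      using m(3) btw_commute by simp
    then have "btw a p b" "btw a q b"
      using btw_glue apq ne by blast+
    then show ?thesis
      using fixes_between[OF z fx(3,4)] by blast
  qed
  then show thesis
    using that pM qM not_ell by blast
qed

text \<open>A form of Serre's lemma on elliptic products: \<open>bridge\<close> with
  \<open>w\<close> the product itself.\<close>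

lemma common_fixed_point:
  assumes "x \<in> carrier G" "y \<in> carrier G" "ell x" "ell y" "ell (x \<otimes> y)"
  shows "\<exists>u\<in>M. \<phi> x u = u \<and> \<phi> y u = u"
  using bridge[of x y] assms by (metis m_closed)

lemma elliptic_mult:
  assumes x: "x \<in> carrier G" "ell x" and y: "y \<in> carrier G" "ell y" and z: "z \<in> carrier G" "ell z"
    and "ell (z \<otimes> x)" "ell (z \<otimes> y)" "ell (x \<otimes> y \<otimes> z)"
  shows "ell (x \<otimes> y)"
proof (rule ccontr)
  assume "\<not> ell (x \<otimes> y)"
  then have "\<nexists>u. u \<in> M \<and> \<phi> x u = u \<and> \<phi> y u = u"
    using x y by (auto simp: elliptic_def)
  then obtain p q where pq: "p \<in> M" "q \<in> M"
    and fx: "\<And>z a b. z \<in> carrier G \<Longrightarrow> a \<in> M \<Longrightarrow> b \<in> M \<Longrightarrow> \<phi> x a = a \<Longrightarrow> \<phi> y b = b \<Longrightarrow>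
      \<phi> z a = a \<Longrightarrow> \<phi> z b = b \<Longrightarrow> \<phi> z p = p \<and> \<phi> z q = q"
    and lox: "\<And>w. w \<in> carrier G \<Longrightarrow> \<phi> w p = \<phi> (x \<otimes> y) p \<Longrightarrow> \<phi> w q = \<phi> (x \<otimes> y) q \<Longrightarrow> \<not> ell w"
    using bridge[OF x y] by blast
  obtain a where a: "a \<in> M" "\<phi> z a = a" "\<phi> x a = a"
    using common_fixed_point[of z x] assms by blast
  obtain b where b: "b \<in> M" "\<phi> z b = b" "\<phi> y b = b"
    using common_fixed_point[of z y] assms by blast
  have "\<phi> z p = p \<and> \<phi> z q = q"
    using fx z a b by blast
  then show False
    using lox[of "x \<otimes> y \<otimes> z"] pq x y z assms by simp
qed

end

section \<open>Axes of loxodromic elements\<close>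

context non_nesting_action
begin

section \<open>Excluding inversions\<close>

lemma not_ell_neq: "\<not> ell g \<Longrightarrow> x \<in> M \<Longrightarrow> \<phi> g x \<noteq> x"
  by (auto simp: elliptic_def)

lemma ell_inv_iff:
  assumes "g \<in> carrier G"
  shows "ell (inv g) \<longleftrightarrow> ell g"
  using assms fixes_inv[of g] fixes_inv[of "inv g"] by (auto simp: elliptic_def)

text \<open>On the path from \<open>m\<close> to \<open>n\<close> the map is an order-reversing
  involution. The supremum \<open>s\<close> of the points preceding their images is an
  order-theoretic midpoint, and it must be fixed.\<close>

lemma swap_imp_elliptic:
  assumes g: "g \<in> carrier G" and M: "m \<in> M" "n \<in> M" and mn: "\<phi> g m = n" "\<phi> g n = m"
  shows "ell g"
proof -
  have invol: "\<phi> g (\<phi> g u) = u" if "btw m u n" for u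
    using fixes_between[of "g \<otimes> g" m n u] that g M mn btw_memD[OF that] by simp
  have act: "btw m (\<phi> g u) n" if "btw m u n" for u
    using act_btw[OF g that] mn btw_commute by simp
  have anti: "btw m (\<phi> g v) (\<phi> g u)" if "btw m u v" "btw m v n" for u v
    using act_btw[OF g that(1)] act_btw[OF g that(2)] mn btw_commute btw_trans by metis
  define S where "S = {u. btw m u n \<and> btw m u (\<phi> g u)}"
  obtain s where s: "btw m s n" "\<And>u. u \<in> S \<Longrightarrow> btw m u s"
      "\<And>t. btw m t n \<Longrightarrow> (\<And>u. u \<in> S \<Longrightarrow> btw m u t) \<Longrightarrow> btw m s t"
    using btw_sup[OF M, of S] by (auto simp: S_def)
  have sM: "s \<in> M"
    using s(1) btw_memD by blast
  define s' where "s' = \<phi> g s"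
  have s': "btw m s' n" "\<phi> g s' = s" "s' \<in> M"
    using act[OF s(1)] invol[OF s(1)] btw_memD by (auto simp: s'_def)
  have "s = s'"
  proof (rule ccontr)
    assume "s \<noteq> s'"
    then obtain v where v: "btw s v s'" "v \<noteq> s" "v \<noteq> s'"
      using btw_dense[OF sM s'(3)] by blast
    have vM: "v \<in> M"
      using v btw_memD by blast
    have gv: "btw s (\<phi> g v) s'"
      using act_btw[OF g v(1)] s'(2) btw_commute by (simp add: s'_def)
    have gv_ne: "\<phi> g v \<noteq> s" "\<phi> g v \<noteq> s'"
      using v s'(2,3) sM vM g by (auto simp: s'_def)
    have vn: "btw m v n" and gvn: "btw m (\<phi> g v) n"
    proof -
      show "btw m v n"
        using btw_linear[OF s(1) s'(1)] v(1) s(1) s'(1)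
        by (meson btw_commute btw_trans btw_trans_right)
      then show "btw m (\<phi> g v) n"
        by (rule act)
    qed
    have ggv: "\<phi> g (\<phi> g v) = v"
      using invol[OF vn] .
    \<comment> \<open>Of the swapped pair \<open>v\<close>, \<open>\<phi> g v\<close>, let
      \<open>w\<close> be the one that comes no earlier than its image. Then
      \<open>\<phi> g w\<close> is in \<open>S\<close>, which excludes \<open>s\<close> before
      \<open>s'\<close>, and \<open>w\<close> bounds \<open>S\<close>, which excludes the reverse
      order.\<close>
    obtain w where w: "w = v \<or> w = \<phi> g v" "btw m (\<phi> g w) w"
      using btw_linear[OF vn gvn] ggv by metis
    have wn: "btw m w n" "btw m (\<phi> g w) n" "\<phi> g (\<phi> g w) = w"
      using w(1) vn gvn ggv by auto
    from btw_linear[OF s(1) s'(1)] show False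
    proof
      assume "btw m s s'"
      then have "btw m s v" "btw m s (\<phi> g v)"
        using v(1) gv btw_trans_right by blast+
      then have "btw m s (\<phi> g w)"
        using w(1) ggv by auto
      moreover have "\<phi> g w \<in> S"
        using wn w(2) by (simp add: S_def)
      ultimately have "\<phi> g w = s"
        using s(2) btw_antisym by blast
      then show False
        using w(1) ggv v gv_ne by auto
    next
      assume "btw m s' s"
      then have "btw m v s" "btw m (\<phi> g v) s"
        using v(1) gv btw_trans_right btw_commute by blast+
      then have ws: "btw m w s"
        using w(1) by auto
      have "btw m u w" if u: "u \<in> S" for u
      proof (rule ccontr)
        assume not: "\<not> btw m u w"
        have "btw m u n" "btw m u (\<phi> g u)"
          using u by (auto simp: S_def)
        moreover from this have "btw m w u"
          using btw_linear wn(1) not by blast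
        ultimately have "btw m u (\<phi> g w)"
          using anti btw_trans by blast
        then show False
          using not w(2) btw_trans by blast
      qed
      then have "btw m s w"
        using s(3) wn(1) by blast
      then have "w = s"
        using ws btw_antisym by blast
      then show False
        using w(1) v gv_ne by auto
    qed
  qed
  then show ?thesis
    using sM unfolding elliptic_def s'_def by metis
qed

section \<open>Axes and projections to them\<close>

text \<open>For loxodromic \<open>g\<close> this is membership in the line translated by
  \<open>g\<close>. Fixed points satisfy the formula too, so it describes an axis only together with
  \<open>\<not> ell g\<close>.\<close>

definition on_axis :: "'b \<Rightarrow> 'a \<Rightarrow> bool" where
  "on_axis g p \<longleftrightarrow> btw p (\<phi> g p) (\<phi> g (\<phi> g p))"

lemma on_axis_memD: "on_axis g p \<Longrightarrow> p \<in> M"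
  using btw_memD by (auto simp: on_axis_def)

lemma on_axis_conj:
  assumes "h \<in> carrier G" "g \<in> carrier G" "g' \<in> carrier G" "h \<otimes> g = g' \<otimes> h" "on_axis g p"
  shows "on_axis g' (\<phi> h p)"
proof -
  have eq: "\<phi> g' (\<phi> h x) = \<phi> h (\<phi> g x)" if "x \<in> M" for x
    using assms that by (metis act_mult)
  show ?thesis
    using act_btw[of h p "\<phi> g p" "\<phi> g (\<phi> g p)"] assms eq on_axis_memD[OF assms(5)]
    by (simp add: on_axis_def)
qed

lemma on_axis_inv:
  assumes "g \<in> carrier G" "on_axis g p"
  shows "on_axis (inv g) p"
proof -
  have M: "p \<in> M"
    using on_axis_memD assms(2) .
  have "on_axis g (\<phi> (inv g \<otimes> inv g) p)"
    by (rule on_axis_conj) (use assms in \<open>auto simp: m_assoc\<close>, simp flip: m_assoc)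
  then show ?thesis
    using assms(1) M btw_commute by (simp add: on_axis_def)
qed

lemma on_axis_mid:
  assumes "g \<in> carrier G" "on_axis g p"
  shows "btw (\<phi> (inv g) p) p (\<phi> g p)"
  using act_btw[of "inv g" p "\<phi> g p" "\<phi> g (\<phi> g p)"] assms on_axis_memD[OF assms(2)]
  by (simp add: on_axis_def)

text \<open>The point \<open>p\<close> is the projection of \<open>t\<close> to the axis of \<open>g\<close>; the second conjunct is the translate by \<open>g\<close> of the
  condition towards \<open>inv g\<close> applied to \<open>p\<close>.\<close>

definition projects :: "'b \<Rightarrow> 'a \<Rightarrow> 'a \<Rightarrow> bool" where
  "projects g t p \<longleftrightarrow> btw t p (\<phi> g p) \<and> btw (\<phi> g t) (\<phi> g p) p"

lemma projects_memD: "projects g t p \<Longrightarrow> t \<in> M \<and> p \<in> M"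
  using btw_memD by (auto simp: projects_def)

lemma projects_inv:
  assumes "g \<in> carrier G" "projects g t p"
  shows "btw t p (\<phi> (inv g) p)"
  using act_btw[of "inv g" "\<phi> g t" "\<phi> g p" p] assms projects_memD[OF assms(2)]
  by (simp add: projects_def)

text \<open>The median \<open>m\<close> of \<open>t\<close> and its next two images and the preimage
  \<open>p\<close> of \<open>m\<close> both lie on the path from \<open>t\<close> to
  \<open>\<phi> g t\<close>. If \<open>p\<close> comes first, it is the projection; in the other
  order \<open>g\<close> would swap \<open>m\<close> and \<open>p\<close>.\<close>

lemma axis_projection:
  assumes g: "g \<in> carrier G" "\<not> ell g" and t: "t \<in> M"
  obtains p where "on_axis g p" "projects g t p"
proof -
  let ?gt = "\<phi> g t" and ?ggt = "\<phi> g (\<phi> g t)"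
  obtain m where m: "btw t m ?gt" "btw ?gt m ?ggt" "btw t m ?ggt"
    using median_exists[of t ?gt ?ggt] g t by auto
  have mM: "m \<in> M"
    using m btw_memD by blast
  define p where "p = \<phi> (inv g) m"
  have p: "p \<in> M" "\<phi> g p = m"
    using g mM by (simp_all add: p_def)
  have tp: "btw t p ?gt"
    using act_btw_inv[of g t p ?gt] m(2) p g t by simp
  from btw_linear[OF tp m(1)] show thesis
  proof
    assume tpm: "btw t p m"
    have "btw p m ?ggt"
      using tpm m(3) btw_trans by blast
    moreover have "btw m (\<phi> g m) ?ggt"
      using act_btw[OF g(1) m(1)] act_btw[OF g(1) tpm] p(2) btw_trans by metis
    ultimately have "btw p m (\<phi> g m)"
      by (rule btw_trans_right)
    moreover have "btw ?gt m p"
      using tpm m(1) btw_trans btw_commute by blast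
    ultimately show thesis
      using that[of p] tpm p(2) by (simp add: on_axis_def projects_def)
  next
    assume tmp: "btw t m p"
    have "btw m p ?gt"
      using tmp tp btw_trans by blast
    moreover have "btw m (\<phi> g m) ?gt"
      using act_btw[OF g(1) tmp] p(2) btw_commute by simp
    ultimately have "btw m p (\<phi> g m) \<or> btw m (\<phi> g m) p"
      by (rule btw_linear)
    moreover have "\<phi> g m \<noteq> m"
      using not_ell_neq g mM by blast
    ultimately have "\<phi> g m = p"
      using segment_nested[of g m p] segment_nested[of "inv g" m "\<phi> g m"] g mM p
      by (auto simp: p_def)
    then have "ell g"
      using swap_imp_elliptic[OF g(1) mM p(1)] p(2) by simp
    then show thesis
      using g(2) by simp
  qed
qed

lemma projects_btw:
  assumes g: "g \<in> carrier G" "\<not> ell g" and v: "projects g u v" and w: "on_axis g w"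
  shows "btw u v w"
proof -
  have M: "u \<in> M" "v \<in> M" "w \<in> M"
    using projects_memD[OF v] on_axis_memD[OF w] by auto
  obtain m where m: "btw u m v" "btw v m w" "btw u m w"
    using median_exists[OF M] by blast
  have "m = v"
  \<comment> \<open>Otherwise \<open>w\<close> hangs off the axis at \<open>v\<close>, and the paths from \<open>w\<close> and \<open>g (g w)\<close> to \<open>g w\<close> share their last piece.\<close>
  proof (rule ccontr)
    assume ne: "m \<noteq> v"
    have mM: "m \<in> M"
      using m btw_memD by blast
    have "btw m v (\<phi> g v)"
      using m(1) v btw_trans unfolding projects_def by blast
    then have 1: "btw w v (\<phi> g v)"
      using btw_glue[OF btw_commute[OF m(2)]] ne by blast
    have "btw (\<phi> g m) (\<phi> g v) v"
      using act_btw[OF g(1) m(1)] v btw_trans unfolding projects_def by blast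
    moreover have "\<phi> g m \<noteq> \<phi> g v"
      using ne g M mM by simp
    ultimately have 2: "btw (\<phi> g w) (\<phi> g v) v"
      using btw_glue[OF act_btw[OF g(1) btw_commute[OF m(2)]]] by blast
    have vg: "v \<noteq> \<phi> g v"
      using not_ell_neq[OF g(2) M(2)] by simp
    have "btw w v (\<phi> g w)" "btw w (\<phi> g v) (\<phi> g w)"
      using btw_glue[OF 1 btw_commute[OF 2] vg] by auto
    moreover from this have "btw (\<phi> g w) (\<phi> g v) (\<phi> g (\<phi> g w))"
      using act_btw[OF g(1)] by blast
    ultimately have "\<phi> g v = \<phi> g w"
      using w unfolding on_axis_def by (metis btw_antisym btw_commute btw_trans)
    then have "v = w"
      using g M by simp
    then show False
      using ne m(2) btw_same by blast
  qed
  then show ?thesis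
    using m(3) by simp
qed

lemma projects_axis_eq:
  "g \<in> carrier G \<Longrightarrow> \<not> ell g \<Longrightarrow> projects g u v \<Longrightarrow> on_axis g u \<Longrightarrow> u = v"
  using projects_btw btw_same by blast

text \<open>If \<open>q\<close> branched off at an interior point \<open>m\<close> of the path from
  \<open>p\<close> to \<open>\<phi> g p\<close>, then \<open>m\<close> would be its projection to
  the axis, so \<open>m = q\<close>.\<close>

lemma axis_trichotomy:
  assumes g: "g \<in> carrier G" "\<not> ell g" and p: "on_axis g p" and q: "on_axis g q"
  shows "btw p (\<phi> g p) q \<or> btw p q (\<phi> g p) \<or> btw q p (\<phi> g p)"
proof -
  have M: "p \<in> M" "q \<in> M"
    using p q on_axis_memD by auto
  obtain m where m: "btw p m q" "btw q m (\<phi> g p)" "btw p m (\<phi> g p)"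
    using median_exists[of p q "\<phi> g p"] M g by auto
  have mM: "m \<in> M"
    using m btw_memD by blast
  have "m = q" if ne: "m \<noteq> p" "m \<noteq> \<phi> g p"
  proof -
    have gm: "btw (\<phi> g p) (\<phi> g m) (\<phi> g (\<phi> g p))"
      using act_btw[OF g(1) m(3)] .
    have "btw m (\<phi> g p) (\<phi> g (\<phi> g p))"
      using m(3) p btw_trans unfolding on_axis_def by blast
    then have mgm: "btw m (\<phi> g p) (\<phi> g m)"
      using gm btw_trans_right by blast
    have "btw q m (\<phi> g m)"
      using m(2) mgm ne(2) btw_trans_right btw_glue by blast
    moreover have "btw (\<phi> g q) (\<phi> g m) m"
    proof -
      have "btw (\<phi> g q) (\<phi> g m) (\<phi> g p)"
        using act_btw[OF g(1) m(1)] btw_commute by blast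
      moreover have "\<phi> g m \<noteq> \<phi> g p"
        using ne(1) g M mM by simp
      ultimately show ?thesis
        using btw_glue btw_commute[OF mgm] by blast
    qed
    ultimately have "projects g q m"
      by (simp add: projects_def)
    then show "m = q"
      using projects_axis_eq g q by blast
  qed
  then show ?thesis
    using m by auto
qed

text \<open>A ray that stays inside a bounded segment would converge to a fixed point.\<close>

lemma ray_unbounded:
  assumes g: "g \<in> carrier G" "\<not> ell g" and p: "on_axis g p" and q: "q \<in> M"
  shows "\<exists>n. \<not> btw p (\<phi> (g [^] (n::nat)) p) q"
proof (rule ccontr)
  define a where "a n = \<phi> (g [^] (n::nat)) p" for n
  have pM: "p \<in> M"
    using on_axis_memD[OF p] .
  have aM: "a n \<in> M" for n
    using g pM by (simp add: a_def)
  have a0: "a 0 = p"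
    using pM by (simp add: a_def)
  have aS: "\<phi> g (a n) = a (Suc n)" for n
    using g pM nat_pow_Suc2[OF g(1)] by (simp add: a_def del: nat_pow_Suc)
  assume "\<nexists>n. \<not> btw p (\<phi> (g [^] (n::nat)) p) q"
  then have bdd: "btw p (a n) q" for n
    by (simp add: a_def)
  obtain s where s: "btw p s q" "\<And>u. u \<in> range a \<Longrightarrow> btw p u s"
      "\<And>t. btw p t q \<Longrightarrow> (\<And>u. u \<in> range a \<Longrightarrow> btw p u t) \<Longrightarrow> btw p s t"
    using btw_sup[OF pM q, of "range a"] bdd by auto
  have sM: "s \<in> M"
    using s(1) btw_memD by blast
  have as: "btw p (a n) s" for n
    using s(2) by blast
  have a12: "btw p (a 1) (a 2)" "a 1 \<noteq> a 2"
    using p aS[of 0] aS[of 1] a0 not_ell_neq[OF g(2) aM[of 1]]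
    by (auto simp: on_axis_def numeral_2_eq_2)
  have mono: "btw p (a 1) (a (Suc n))" for n
  proof (induction n)
    case 0
    then show ?case
      using pM aM by simp
  next
    case (Suc n)
    have "btw (a 1) (a 2) (a (Suc (Suc n)))"
      using act_btw[OF g(1) Suc.IH] aS[of 0] aS[of 1] aS[of "Suc n"] a0 by (simp add: numeral_2_eq_2)
    then show ?case
      using btw_glue a12 by blast
  qed
  have gas: "btw (a 1) (a (Suc n)) (\<phi> g s)" for n
    using act_btw[OF g(1) as[of n]] aS[of n] aS[of 0] a0 by simp
  have "btw p (a 1) (\<phi> g s)"
    using btw_glue(2)[OF a12(1) _ a12(2)] gas[of 1] by (simp add: numeral_2_eq_2)
  then have ags: "btw p (a n) (\<phi> g s)" for n
  proof (cases n)
    case 0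
    then show ?thesis
      using a0 pM act_mem[OF g(1) sM] by simp
  next
    case (Suc k)
    then show ?thesis
      using btw_trans_right(1)[OF \<open>btw p (a 1) (\<phi> g s)\<close> gas[of k]] by simp
  qed
  \<comment> \<open>The orbit precedes both \<open>s\<close> and \<open>\<phi> g s\<close>, hence
    also \<open>m\<close>, which forces \<open>m = s\<close>.\<close>
  obtain m where m: "btw p m s" "btw s m (\<phi> g s)" "btw p m (\<phi> g s)"
    using median_exists[of p s "\<phi> g s"] pM sM g by auto
  have "btw p u m" if "u \<in> range a" for u
    using btw_median m as ags that by blast
  then have "btw p s m"
    using s(3) m(1) s(1) btw_trans by blast
  then have "btw p s (\<phi> g s)"
    using m btw_antisym by blast
  then have "btw (a 1) s (\<phi> g s)"
    using as btw_trans by blast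
  then have "btw p (\<phi> (inv g) s) s"
    using act_btw_inv[of g p "\<phi> (inv g) s" s] g pM sM aS[of 0] a0 by simp
  \<comment> \<open>As \<open>s\<close> also bounds the shifted orbit,
    \<open>\<phi> (inv g) s\<close> bounds the orbit itself.\<close>
  moreover have "btw p s (\<phi> (inv g) s)"
  proof (rule s(3))
    show "btw p (\<phi> (inv g) s) q"
      using calculation s(1) btw_trans by blast
    show "btw p u (\<phi> (inv g) s)" if "u \<in> range a" for u
    proof -
      obtain n where n: "u = a n"
        using \<open>u \<in> range a\<close> by blast
      have "btw (a 1) (a (Suc n)) s"
        using mono as btw_trans by blast
      then show ?thesis
        using act_btw_inv[of g p "a n" "\<phi> (inv g) s"] g pM sM aM aS[of 0] aS[of n] a0 n by simp
    qed
  qed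
  ultimately have "\<phi> (inv g) s = s"
    using btw_antisym by blast
  then show False
    using ell_inv_iff[OF g(1)] g(2) sM by (auto simp: elliptic_def)
qed

section \<open>Fundamental domains along an axis\<close>

text \<open>The hypothesis \<open>not\<close> keeps \<open>q\<close> from lying behind
  \<open>p\<close>. By \<open>ray_unbounded\<close> there is a first domain that \<open>q\<close> is
  not beyond, and \<open>q\<close> is in it.\<close>

lemma axis_transitive_forward:
  assumes g: "g \<in> carrier G" "\<not> ell g" and p: "on_axis g p" and q: "on_axis g q"
    and not: "\<not> btw q p (\<phi> g p)"
  shows "\<exists>n. btw (\<phi> (g [^] (n::nat)) p) q (\<phi> g (\<phi> (g [^] n) p))"
proof -
  define a where "a n = \<phi> (g [^] (n::nat)) p" for n
  have pM: "p \<in> M" and qM: "q \<in> M"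
    using on_axis_memD p q by auto
  have aM: "a n \<in> M" for n
    using g pM by (simp add: a_def)
  have a0: "a 0 = p"
    using pM by (simp add: a_def)
  have aS: "\<phi> g (a n) = a (Suc n)" for n
    using g pM nat_pow_Suc2[OF g(1)] by (simp add: a_def del: nat_pow_Suc)
  have ax: "on_axis g (a n)" for n
    unfolding a_def using g p nat_pow_comm[OF g(1), of n 1] by (intro on_axis_conj) auto
  have "\<exists>n. \<not> btw (a n) (a (Suc n)) q"
  proof (rule ccontr)
    assume "\<nexists>n. \<not> btw (a n) (a (Suc n)) q"
    then have step: "btw (a n) (a (Suc n)) q" for n
      by blast
    have "btw p (a n) q" for n
    proof (induction n)
      case 0
      then show ?case
        using a0 pM qM by simp
    next
      case (Suc n)
      then show ?case
        using step btw_trans_right by blast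
    qed
    then show False
      using ray_unbounded[OF g p qM] by (auto simp: a_def)
  qed
  then obtain n where n: "\<not> btw (a n) (a (Suc n)) q" "\<And>k. k < n \<Longrightarrow> btw (a k) (a (Suc k)) q"
    using exists_least_iff[of "\<lambda>n. \<not> btw (a n) (a (Suc n)) q"] by blast
  have tri: "btw (a n) q (a (Suc n)) \<or> btw q (a n) (a (Suc n))"
    using axis_trichotomy[OF g ax q, of n] n(1) aS by auto
  have "btw (a n) q (a (Suc n))"
  proof (cases n)
    case 0
    then show ?thesis
      using tri not a0 aS[of 0] by simp
  next
    case (Suc k)
    have "btw (a k) (a n) q"
      using n(2) Suc by simp
    then have "btw q (a n) (a k)"
      by (rule btw_commute)
    then have "btw (\<phi> g q) (\<phi> g (a n)) (a n)"
      using act_btw[OF g(1)] aS Suc by metis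
    \<comment> \<open>Lying beyond the previous domain and also behind \<open>a n\<close>, the point
      \<open>q\<close> projects to \<open>a n\<close>.\<close>
    then have "projects g q (a n)" if "btw q (a n) (a (Suc n))"
      using that aS by (simp add: projects_def)
    then have "q = a n" if "btw q (a n) (a (Suc n))"
      using that projects_axis_eq g q by blast
    then show ?thesis
      using tri aM by auto
  qed
  then show ?thesis
    using aS by (auto simp: a_def)
qed

lemma axis_transitive:
  assumes g: "g \<in> carrier G" "\<not> ell g" and p: "on_axis g p" and q: "on_axis g q"
  obtains h where "h \<in> carrier G" "h \<otimes> g = g \<otimes> h" "btw p (\<phi> h q) (\<phi> g p)"
proof -
  have pM: "p \<in> M" and qM: "q \<in> M"
    using on_axis_memD p q by auto
  have inv_commute: "inv h \<otimes> g = g \<otimes> inv h" if "h \<in> carrier G" "h \<otimes> g = g \<otimes> h" for h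
    using that g by (metis inv_closed inv_solve_left inv_solve_right m_assoc m_closed)
  show thesis
  proof (cases "btw q p (\<phi> g p)")
    case False
    then obtain n where n: "btw (\<phi> (g [^] (n::nat)) p) q (\<phi> g (\<phi> (g [^] n) p))"
      using axis_transitive_forward g p q by blast
    define k where "k = g [^] n"
    have k: "k \<in> carrier G" "k \<otimes> g = g \<otimes> k"
      using g nat_pow_comm[OF g(1), of n 1] by (auto simp: k_def)
    have "\<phi> g (\<phi> k p) = \<phi> k (\<phi> g p)"
      using k g pM by (metis act_mult)
    then have "btw p (\<phi> (inv k) q) (\<phi> g p)"
      using n act_btw_inv[of k p "\<phi> (inv k) q" "\<phi> g p"] k g pM qM by (simp add: k_def)
    then show thesis
      using that[OF inv_closed[OF k(1)] inv_commute[OF k]] by blast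
  next
    case True
    show thesis
    proof (cases "btw q p (\<phi> (inv g) p)")
      case True
      then have "projects g q p"
        using \<open>btw q p (\<phi> g p)\<close> act_btw[OF g(1), of q p "\<phi> (inv g) p"] g pM
        by (simp add: projects_def)
      then have "q = p"
        using projects_axis_eq g q by blast
      then show thesis
        using that[of "\<one>"] g pM by simp
    next
      case False
      then obtain n where n: "btw (\<phi> (inv g [^] (n::nat)) p) q (\<phi> (inv g) (\<phi> (inv g [^] n) p))"
        using axis_transitive_forward[of "inv g" p q] g p q on_axis_inv ell_inv_iff by auto
      \<comment> \<open>Read in the direction of \<open>g\<close>, the domain found starts at its
        far end, hence \<open>Suc n\<close>.\<close>
      define k where "k = inv g [^] (Suc n)"
      have k: "k \<in> carrier G" "k \<otimes> inv g = inv g \<otimes> k"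
        using g nat_pow_comm[of "inv g" "Suc n" 1] by (auto simp: k_def)
      then have kg: "k \<otimes> g = g \<otimes> k"
        using g by (metis inv_closed inv_inv inv_solve_left inv_solve_right m_assoc m_closed)
      have 1: "\<phi> (inv g) (\<phi> (inv g [^] n) p) = \<phi> k p"
        using g pM nat_pow_Suc2[of "inv g" n] by (simp add: k_def del: nat_pow_Suc)
      have "\<phi> k (\<phi> g p) = \<phi> g (\<phi> k p)"
        using k kg g pM by (metis act_mult)
      then have 2: "\<phi> (inv g [^] n) p = \<phi> k (\<phi> g p)"
        using 1 g pM by (metis act_inv(2) act_mem inv_closed nat_pow_closed)
      have "btw (\<phi> k p) q (\<phi> k (\<phi> g p))"
        using n 1 2 btw_commute by simp
      then have "btw p (\<phi> (inv k) q) (\<phi> g p)"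
        using act_btw_inv[of k p "\<phi> (inv k) q" "\<phi> g p"] k g pM qM by simp
      then show thesis
        using that[OF inv_closed[OF k(1)] inv_commute[OF k(1) kg]] by blast
    qed
  qed
qed

text \<open>The nesting argument: as \<open>c\<close> is conjugate to \<open>a\<close>, some
  \<open>f\<close> carries its domain at \<open>q\<close> to a domain of \<open>a\<close> starting
  between \<open>u\<close> and \<open>\<phi> a u\<close>, hence ending before
  \<open>\<phi> a (\<phi> a u)\<close>, inside the original segment.\<close>

lemma axis_period_not_shorter:
  assumes a: "a \<in> carrier G" "\<not> ell a" and c: "c \<in> carrier G"
    and k: "k \<in> carrier G" "k \<otimes> c = a \<otimes> k"
    and q: "on_axis c q" and u: "on_axis a u"
    and sub: "btw q u (\<phi> c q)" "btw q (\<phi> a (\<phi> a u)) (\<phi> c q)"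
  shows False
proof -
  have qM: "q \<in> M" and uM: "u \<in> M"
    using on_axis_memD q u by auto
  have "on_axis a (\<phi> k q)"
    using on_axis_conj k c a q by blast
  then obtain h where h: "h \<in> carrier G" "h \<otimes> a = a \<otimes> h" "btw u (\<phi> h (\<phi> k q)) (\<phi> a u)"
    using axis_transitive a u by blast
  define f where "f = h \<otimes> k"
  have f: "f \<in> carrier G"
    using h k by (simp add: f_def)
  define s where "s = \<phi> f q"
  have us: "btw u s (\<phi> a u)"
    using h k qM by (simp add: s_def f_def)
  have sM: "s \<in> M"
    using f qM by (simp add: s_def)
  have "\<phi> k (\<phi> c q) = \<phi> a (\<phi> k q)"
    using a(1) c k qM by (metis act_mult)
  moreover have "\<phi> h (\<phi> a (\<phi> k q)) = \<phi> a (\<phi> h (\<phi> k q))"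
    using a(1) h(1,2) k(1) qM by (metis act_mem act_mult)
  ultimately have fc: "\<phi> f (\<phi> c q) = \<phi> a s"
    using h(1) k(1) c qM by (simp add: s_def f_def)
  have au: "btw u (\<phi> a u) (\<phi> a (\<phi> a u))"
    using u by (simp add: on_axis_def)
  have as: "btw (\<phi> a u) (\<phi> a s) (\<phi> a (\<phi> a u))"
    using act_btw[OF a(1) us] .
  have us2: "btw u s (\<phi> a (\<phi> a u))"
    using us au btw_trans by blast
  have as2: "btw u (\<phi> a s) (\<phi> a (\<phi> a u))"
    using as au btw_trans_right by blast
  have inside: "btw q x (\<phi> c q)" if "btw u x (\<phi> a (\<phi> a u))" for x
    using btw_linear[OF sub] that sub by (meson btw_commute btw_trans btw_trans_right)
  have "\<phi> f q = q \<and> \<phi> f (\<phi> c q) = \<phi> c q \<or> \<phi> f q = \<phi> c q \<and> \<phi> f (\<phi> c q) = q"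
    by (rule segment_nested) (use f fc inside us2 as2 in \<open>auto simp flip: s_def\<close>)
  \<comment> \<open>Up to orientation \<open>f\<close> preserves the segment, so the single domain
    from \<open>s\<close> would contain the two domains from \<open>u\<close>.\<close>
  then have "btw s u (\<phi> a s)" "btw s (\<phi> a (\<phi> a u)) (\<phi> a s)"
    using sub fc btw_commute by (auto simp: s_def)
  moreover have "btw u s (\<phi> a s)"
    using us as au by (meson btw_trans btw_trans_right)
  moreover have "btw s (\<phi> a s) (\<phi> a (\<phi> a u))"
    using calculation(3) as2 btw_trans by blast
  ultimately have "u = s" "\<phi> a s = \<phi> a (\<phi> a u)"
    by (meson btw_antisym btw_commute btw_trans)+
  then have "\<phi> a u = u"
    using a uM by simp
  then show False
    using not_ell_neq a uM by blast
qed

text \<open>Gluing lines up \<open>q\<close>, \<open>u\<close> and the images of \<open>u\<close>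
  under \<open>x\<close>, \<open>x b\<close> and \<open>x b x\<close>; the first, third and fifth
  points are successive images of \<open>q\<close> under \<open>x \<otimes> b\<close>.\<close>

lemma product_axis:
  assumes b: "b \<in> carrier G" and x: "x \<in> carrier G" and qM: "q \<in> M"
    and u: "u = \<phi> b q" and ne: "u \<noteq> \<phi> x u" "u \<noteq> \<phi> b u"
    and 1: "btw q u (\<phi> x u)" and 2: "btw u (\<phi> x u) (\<phi> x (\<phi> b u))"
  shows "on_axis (x \<otimes> b) q" "btw q u (\<phi> (x \<otimes> b) q)"
proof -
  have uM: "u \<in> M"
    using u b qM by simp
  have c: "\<phi> (x \<otimes> b) q = \<phi> x u" "\<phi> (x \<otimes> b) (\<phi> x u) = \<phi> x (\<phi> b (\<phi> x u))"
    using b x qM uM u by simp_all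
  have "btw q (\<phi> x u) (\<phi> x (\<phi> b u))"
    using btw_glue[OF 1 2 ne(1)] by simp
  moreover have "btw (\<phi> x u) (\<phi> x (\<phi> b u)) (\<phi> x (\<phi> b (\<phi> x u)))"
    using act_btw[OF x act_btw[OF b 1]] u by simp
  moreover have "\<phi> x u \<noteq> \<phi> x (\<phi> b u)"
    using ne(2) x b uM by simp
  ultimately have "btw q (\<phi> x u) (\<phi> x (\<phi> b (\<phi> x u)))"
    using btw_glue by blast
  then show "on_axis (x \<otimes> b) q"
    using c by (simp add: on_axis_def)
  show "btw q u (\<phi> (x \<otimes> b) q)"
    using 1 c by simp
qed

text \<open>Hypotheses \<open>1\<close> and \<open>2\<close> say that steps of \<open>e\<close> and
  \<open>x\<close> do not cancel at \<open>u\<close>. The domain of the product at \<open>q\<close>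
  then begins with the two domains of \<open>e\<close> from \<open>q\<close> to
  \<open>u\<close>.\<close>

lemma product_square_axis:
  assumes e: "e \<in> carrier G" "\<not> ell e" "on_axis e u" and x: "x \<in> carrier G" "\<not> ell x"
    and 1: "btw (\<phi> (inv e) u) u (\<phi> x u)" and 2: "btw (\<phi> (inv x) u) u (\<phi> e u)"
    and q: "q = \<phi> (inv e) (\<phi> (inv e) u)"
  shows "on_axis (x \<otimes> (e \<otimes> e)) q" "btw q u (\<phi> (x \<otimes> (e \<otimes> e)) q)"
proof -
  have uM: "u \<in> M"
    using e on_axis_memD by blast
  have qM: "q \<in> M" and uq: "u = \<phi> (e \<otimes> e) q"
    using e uM by (simp_all add: q)
  have eu: "btw u (\<phi> e u) (\<phi> e (\<phi> e u))"
    using e by (simp add: on_axis_def)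
  then have ne: "u \<noteq> \<phi> (e \<otimes> e) u"
    using e uM not_ell_neq[OF e(2) uM] btw_same by fastforce
  have "btw (\<phi> (inv x) u) u (\<phi> (e \<otimes> e) u)"
    using btw_glue(2)[OF 2 eu] not_ell_neq[OF e(2) uM] e(1) uM by (metis act_mult)
  then have B2: "btw u (\<phi> x u) (\<phi> x (\<phi> (e \<otimes> e) u))"
    using act_btw[OF x(1), of "\<phi> (inv x) u" u "\<phi> (e \<otimes> e) u"] x uM by simp
  have "on_axis (inv e) u"
    using on_axis_inv e by blast
  then have "btw q (\<phi> (inv e) u) u"
    using btw_commute by (simp add: on_axis_def q)
  moreover have "\<phi> (inv e) u \<noteq> u"
    using not_ell_neq[of "inv e"] ell_inv_iff e uM by blast
  ultimately have B1: "btw q u (\<phi> x u)"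
    using btw_glue 1 by blast
  have "u \<noteq> \<phi> x u"
    using not_ell_neq x uM by metis
  then show "on_axis (x \<otimes> (e \<otimes> e)) q" "btw q u (\<phi> (x \<otimes> (e \<otimes> e)) q)"
    using product_axis[OF _ x(1) qM uq _ ne B1 B2] e by auto
qed

section \<open>Products with squares of a loxodromic element\<close>

lemma btw_germ:
  assumes "btw z u z'" "y \<in> M"
  shows "btw y u z \<or> btw y u z'"
proof -
  obtain m where m: "btw y m z" "btw z m z'" "btw y m z'"
    using median_exists[of y z z'] btw_memD[OF assms(1)] assms(2) by auto
  from btw_linear[OF m(2) assms(1)] show ?thesis
    using m assms(1) by (meson btw_commute btw_trans btw_trans_right)
qed

lemma ell_conj_iff:
  assumes "h \<in> carrier G" "g \<in> carrier G"
  shows "ell (h \<otimes> g \<otimes> inv h) \<longleftrightarrow> ell g"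
proof
  assume "ell g"
  then obtain u where u: "u \<in> M" "\<phi> g u = u"
    by (auto simp: elliptic_def)
  then have "\<phi> (h \<otimes> g \<otimes> inv h) (\<phi> h u) = \<phi> h u"
    using assms by simp
  then show "ell (h \<otimes> g \<otimes> inv h)"
    unfolding elliptic_def using act_mem[OF assms(1) u(1)] by (rule bexI)
next
  assume "ell (h \<otimes> g \<otimes> inv h)"
  then obtain u where u: "u \<in> M" "\<phi> (h \<otimes> g \<otimes> inv h) u = u"
    by (auto simp: elliptic_def)
  then have "\<phi> h (\<phi> g (\<phi> (inv h) u)) = u"
    using assms by simp
  then have "\<phi> g (\<phi> (inv h) u) = \<phi> (inv h) u"
    using act_inv(1)[of h "\<phi> g (\<phi> (inv h) u)"] assms u(1) by simp
  then show "ell g"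
    unfolding elliptic_def using act_mem[OF inv_closed[OF assms(1)] u(1)] by (rule bexI)
qed

text \<open>For at least one of \<open>a\<close> and \<open>inv a\<close> nothing cancels against
  \<open>x\<close>, and \<open>axis_period_not_shorter\<close> refutes that case.\<close>

lemma loxodromic_squares:
  assumes a: "a \<in> carrier G" "\<not> ell a" and x: "x \<in> carrier G" "\<not> ell x" and "M \<noteq> {}"
    and k: "k \<in> carrier G" "k \<otimes> (x \<otimes> (a \<otimes> a)) = a \<otimes> k"
    and k': "k' \<in> carrier G" "k' \<otimes> (x \<otimes> (inv a \<otimes> inv a)) = a \<otimes> k'"
  shows False
proof -
  obtain v0 where v0: "on_axis x v0"
    using axis_projection x \<open>M \<noteq> {}\<close> by (metis ex_in_conv)
  then obtain u where u: "on_axis a u" "projects a v0 u"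
    using axis_projection a on_axis_memD by blast
  then have uM: "u \<in> M"
    using on_axis_memD by blast
  then obtain v where v: "on_axis x v" "projects x u v"
    using axis_projection x by blast
  have vM: "v \<in> M"
    using on_axis_memD v by blast
  have pos: False if 1: "btw (\<phi> (inv a) u) u (\<phi> x u)" and 2: "btw (\<phi> (inv x) u) u (\<phi> a u)"
  proof -
    define q where "q = \<phi> (inv a) (\<phi> (inv a) u)"
    have qM: "q \<in> M" and aq: "\<phi> a (\<phi> a q) = u"
      using a uM by (simp_all add: q_def)
    have q: "on_axis (x \<otimes> (a \<otimes> a)) q" "btw q u (\<phi> (x \<otimes> (a \<otimes> a)) q)"
      using product_square_axis[OF a u(1) x 1 2 q_def] by auto
    have "on_axis a q"
      unfolding q_def using a u(1) by (intro on_axis_conj) auto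
    then show False
      using axis_period_not_shorter[OF a _ k q(1), of q] q(2) a(1) x(1) aq qM btw_memD[OF q(2)]
      by (metis btw_left m_closed)
  qed
  have neg: False if 1: "btw (\<phi> a u) u (\<phi> x u)" and 2: "btw (\<phi> (inv x) u) u (\<phi> (inv a) u)"
  proof -
    define q where "q = \<phi> a (\<phi> a u)"
    have q: "on_axis (x \<otimes> (inv a \<otimes> inv a)) q" "btw q u (\<phi> (x \<otimes> (inv a \<otimes> inv a)) q)"
      using product_square_axis[of "inv a" u x q] a u(1) x 1 2 on_axis_inv ell_inv_iff
      by (auto simp: q_def)
    \<comment> \<open>Here the two domains of \<open>a\<close> run from \<open>u\<close> to
      \<open>q\<close>, not from \<open>q\<close> to \<open>u\<close>.\<close>
    then show False
      using axis_period_not_shorter[OF a _ k' q(1) u(1)] a x btw_memD[OF q(2)]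
      by (simp add: q_def)
  qed
  show False
  proof (cases "u = v")
    case True
    have am: "btw (\<phi> (inv a) u) u (\<phi> a u)" and xm: "btw (\<phi> (inv x) u) u (\<phi> x u)"
      using on_axis_mid a x u(1) v(1) True by auto
    have M: "\<phi> a u \<in> M" "\<phi> (inv a) u \<in> M" "\<phi> x u \<in> M" "\<phi> (inv x) u \<in> M"
      using a x uM by auto
    \<comment> \<open>Each direction at \<open>u\<close> is separated from at least one direction of
      the other axis. The four alternatives together imply the hypotheses of \<open>pos\<close> or
      those of \<open>neg\<close>.\<close>
    show False
      using pos neg btw_germ[OF xm M(1)] btw_germ[OF xm M(2)] btw_germ[OF am M(3)]
        btw_germ[OF am M(4)] btw_commute by blast
  next
    case False
    \<comment> \<open>Now the path from \<open>u\<close> to \<open>v\<close> leads from one axis to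
      the other and separates their directions, so \<open>pos\<close> applies.\<close>
    have v0v: "btw v0 v u"
      using projects_btw[OF x v(2) v0] btw_commute by blast
    have vua: "btw v u (\<phi> a u)" "btw v u (\<phi> (inv a) u)"
      using v0v u(2) projects_inv[OF a(1) u(2)] btw_trans unfolding projects_def by blast+
    have uv: "btw u v (\<phi> x v)" "btw u v (\<phi> (inv x) v)"
      using v(2) projects_inv[OF x(1) v(2)] by (auto simp: projects_def)
    have xv: "btw v (\<phi> x v) (\<phi> x u)"
      using act_btw[OF x(1) uv(2)] x vM btw_commute by simp
    have ixv: "btw v (\<phi> (inv x) v) (\<phi> (inv x) u)"
      using act_btw[of "inv x", OF _ uv(1)] x vM btw_commute by simp
    have "v \<noteq> \<phi> x v" "v \<noteq> \<phi> (inv x) v"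
      using not_ell_neq x vM ell_inv_iff by metis+
    then have "btw u v (\<phi> x u)" "btw u v (\<phi> (inv x) u)"
      using btw_glue uv xv ixv by blast+
    then have "btw (\<phi> (inv a) u) u (\<phi> x u)" "btw (\<phi> (inv x) u) u (\<phi> a u)"
      using btw_glue vua False btw_commute by blast+
    then show False
      by (rule pos)
  qed
qed

end

section \<open>Translates of comeagre sets\<close>

lemma (in Polish_group) right_translation_continuous:
  assumes "a \<in> carrier G"
  shows "continuous_map X X (\<lambda>z. z \<otimes> a)"
proof -
  have "continuous_map X (prod_topology X X) (\<lambda>z. (z, a))"
    using assms topspace_eq by (intro continuous_map_pairedI) auto
  then have "continuous_map X X ((\<lambda>(g, h). g \<otimes> h) \<circ> (\<lambda>z. (z, a)))"
    using continuous_mult continuous_map_compose by blast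
  then show ?thesis
    by (simp add: o_def)
qed

lemma (in Polish_group) right_translation_dense_open:
  assumes a: "a \<in> carrier G" and V: "openin X V" "X closure_of V = topspace X"
  defines "V' \<equiv> {z \<in> topspace X. z \<otimes> a \<in> V}"
  shows "openin X V' \<and> X closure_of V' = topspace X"
proof
  show "openin X V'"
    unfolding V'_def
    using openin_continuous_map_preimage[OF right_translation_continuous[OF a] V(1)] .
  show "X closure_of V' = topspace X"
    unfolding dense_intersects_open
  proof (intro allI impI)
    fix W assume W: "openin X W \<and> W \<noteq> {}"
    define W' where "W' = {z \<in> topspace X. z \<otimes> inv a \<in> W}"
    have "openin X W'"
      unfolding W'_def
      using openin_continuous_map_preimage[OF right_translation_continuous] a W by blast
    moreover have "W' \<noteq> {}"
    proof -
      obtain w where w: "w \<in> W"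
        using W by blast
      then have "w \<in> carrier G"
        using W openin_subset topspace_eq by blast
      then have "w \<otimes> a \<in> W'"
        using w a by (simp add: W'_def topspace_eq m_assoc)
      then show ?thesis
        by blast
    qed
    ultimately obtain z where z: "z \<in> V" "z \<in> W'"
      using V(2) dense_intersects_open[of X V] by blast
    then have "z \<otimes> inv a \<in> V' \<inter> W"
      using a by (simp add: V'_def W'_def topspace_eq m_assoc)
    then show "V' \<inter> W \<noteq> {}"
      by blast
  qed
qed

lemma (in Polish_group) comeagre_translates_meet:
  assumes C: "comeagre_in X C" and A: "countable A" "A \<subseteq> carrier G"
  obtains z where "z \<in> carrier G" "\<And>a. a \<in> A \<Longrightarrow> z \<otimes> a \<in> C"
proof -
  obtain \<U> where U: "countable \<U>" "\<And>U. U \<in> \<U> \<Longrightarrow> openin X U \<and> X closure_of U = topspace X"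
    and sub: "topspace X \<inter> \<Inter>\<U> \<subseteq> C"
    using C by (auto simp: comeagre_in_def)
  define \<V> where "\<V> = (\<Union>a\<in>A. (\<lambda>V. {z \<in> topspace X. z \<otimes> a \<in> V}) ` \<U>)"
  have "X closure_of \<Inter>\<V> = topspace X"
  proof (rule Baire_category)
    show "countable \<V>"
      using A(1) U(1) by (auto simp: \<V>_def)
    show "openin X T \<and> X closure_of T = topspace X" if "T \<in> \<V>" for T
      using that right_translation_dense_open U(2) A(2) by (auto simp: \<V>_def)
  qed (use completely_metrizable in simp)
  \<comment> \<open>The closure contains the unit, so the intersection cannot be empty.\<close>
  then have "topspace X \<inter> \<Inter>\<V> \<noteq> {}"
    using closure_of_restrict[of X "\<Inter>\<V>"] topspace_eq one_closed by fastforce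
  then obtain z where z: "z \<in> carrier G" "z \<in> \<Inter>\<V>"
    using topspace_eq by blast
  have "z \<otimes> a \<in> C" if "a \<in> A" for a
  proof -
    have "z \<otimes> a \<in> U" if "U \<in> \<U>" for U
      using z(2) \<open>a \<in> A\<close> that by (auto simp: \<V>_def)
    then show ?thesis
      using sub z(1) A(2) \<open>a \<in> A\<close> topspace_eq m_closed by blast
  qed
  then show thesis
    using that z(1) by blast
qed

theorem theorem2p1:
  fixes G :: "('g, 'm) monoid_scheme" and X :: "'g topology"
    and T :: "'a set" and d :: "'a \<Rightarrow> 'a \<Rightarrow> real" and \<phi> :: "'g \<Rightarrow> 'a \<Rightarrow> 'a"
  assumes "Polish_group G X"
    and "\<exists>c\<in>carrier G. comeagre_in X (conjugacy_class G c)"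
    and "R_tree_action T d G \<phi>"
    and "T \<noteq> {}"
    and "Metric_space.non_nesting T d G \<phi>"
  shows "\<forall>g\<in>carrier G. elliptic T \<phi> g"
proof
  interpret P: Polish_group G X
    by fact
  interpret R_tree_action T d G \<phi>
    by fact
  interpret non_nesting_action T d G \<phi>
    by unfold_locales fact
  fix g assume g: "g \<in> carrier G"
  obtain c where c: "c \<in> carrier G" and meagre: "comeagre_in X (conjugacy_class G c)"
    using assms(2) by blast
  \<comment> \<open>Membership in the class is recorded as an intertwining relation with
    \<open>c\<close>, as \<open>loxodromic_squares\<close> expects.\<close>
  have conj: "\<exists>k\<in>carrier G. k \<otimes>\<^bsub>G\<^esub> h = c \<otimes>\<^bsub>G\<^esub> k \<and> (ell h \<longleftrightarrow> ell c)"
    if h: "h \<in> conjugacy_class G c" for h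
  proof -
    obtain k where k: "k \<in> carrier G" "h = k \<otimes>\<^bsub>G\<^esub> c \<otimes>\<^bsub>G\<^esub> inv\<^bsub>G\<^esub> k"
      using h by (auto simp: conjugacy_class_def)
    have "inv\<^bsub>G\<^esub> k \<otimes>\<^bsub>G\<^esub> h = c \<otimes>\<^bsub>G\<^esub> inv\<^bsub>G\<^esub> k"
      using k c by (simp add: P.m_assoc P.inv_solve_left')
    then show ?thesis
      using k c ell_conj_iff by (metis P.inv_closed)
  qed
  show "ell g"
  proof (cases "ell c")
    case False
    let ?A = "{\<one>\<^bsub>G\<^esub>, c \<otimes>\<^bsub>G\<^esub> c, inv\<^bsub>G\<^esub> c \<otimes>\<^bsub>G\<^esub> inv\<^bsub>G\<^esub> c}"
    obtain x where x: "x \<in> carrier G" "\<And>a. a \<in> ?A \<Longrightarrow> x \<otimes>\<^bsub>G\<^esub> a \<in> conjugacy_class G c"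
      by (rule P.comeagre_translates_meet[OF meagre, of ?A]) (use c in auto)
    have "x \<in> conjugacy_class G c"
      using x(2)[of "\<one>\<^bsub>G\<^esub>"] x(1) by simp
    then have "\<not> ell x"
      using conj False by blast
    moreover obtain k where "k \<in> carrier G" "k \<otimes>\<^bsub>G\<^esub> (x \<otimes>\<^bsub>G\<^esub> (c \<otimes>\<^bsub>G\<^esub> c)) = c \<otimes>\<^bsub>G\<^esub> k"
      using conj x(2) by blast
    moreover obtain k' where "k' \<in> carrier G"
      "k' \<otimes>\<^bsub>G\<^esub> (x \<otimes>\<^bsub>G\<^esub> (inv\<^bsub>G\<^esub> c \<otimes>\<^bsub>G\<^esub> inv\<^bsub>G\<^esub> c)) = c \<otimes>\<^bsub>G\<^esub> k'"
      using conj x(2) by blast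
    ultimately show ?thesis
      using loxodromic_squares[OF c False x(1)] assms(4) by blast
  next
    case True
    then have ellC: "ell h" if "h \<in> conjugacy_class G c" for h
      using conj that by blast
    obtain w where w: "w \<in> carrier G" "\<And>a. a \<in> {\<one>\<^bsub>G\<^esub>, g} \<Longrightarrow> w \<otimes>\<^bsub>G\<^esub> a \<in> conjugacy_class G c"
      by (rule P.comeagre_translates_meet[OF meagre, of "{\<one>\<^bsub>G\<^esub>, g}"]) (use g in auto)
    \<comment> \<open>Both \<open>w\<close> and \<open>w g\<close> lie in the class, so this splits
      \<open>g\<close> into two elliptic factors.\<close>
    define x where "x = inv\<^bsub>G\<^esub> w"
    define y where "y = w \<otimes>\<^bsub>G\<^esub> g"
    have x: "x \<in> carrier G" "ell x"
      using w(1) w(2)[of "\<one>\<^bsub>G\<^esub>"] ellC ell_inv_iff by (auto simp: x_def)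
    have y: "y \<in> carrier G" "ell y"
      using w(1) w(2)[of g] ellC g by (auto simp: y_def)
    have xy: "x \<otimes>\<^bsub>G\<^esub> y = g"
      using w(1) g by (simp add: x_def y_def flip: P.m_assoc)
    obtain z where z: "z \<in> carrier G"
      "\<And>a. a \<in> {\<one>\<^bsub>G\<^esub>, x, y, g} \<Longrightarrow> z \<otimes>\<^bsub>G\<^esub> a \<in> conjugacy_class G c"
      by (rule P.comeagre_translates_meet[OF meagre, of "{\<one>\<^bsub>G\<^esub>, x, y, g}"]) (use g x y in auto)
    have zell: "ell z" "ell (z \<otimes>\<^bsub>G\<^esub> x)" "ell (z \<otimes>\<^bsub>G\<^esub> y)" "ell (z \<otimes>\<^bsub>G\<^esub> g)"
      using z(2)[of "\<one>\<^bsub>G\<^esub>"] z(2)[of x] z(2)[of y] z(2)[of g] z(1) ellC by auto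
    \<comment> \<open>\<open>elliptic_mult\<close> needs \<open>z\<close> on the right of the
      product, whereas the choice of \<open>z\<close> puts it on the left.\<close>
    have "inv\<^bsub>G\<^esub> z \<otimes>\<^bsub>G\<^esub> (z \<otimes>\<^bsub>G\<^esub> g) \<otimes>\<^bsub>G\<^esub> inv\<^bsub>G\<^esub> (inv\<^bsub>G\<^esub> z) = g \<otimes>\<^bsub>G\<^esub> z"
      using z(1) g by (simp flip: P.m_assoc)
    then have "ell (g \<otimes>\<^bsub>G\<^esub> z)"
      using ell_conj_iff[of "inv\<^bsub>G\<^esub> z" "z \<otimes>\<^bsub>G\<^esub> g"] z(1) g zell(4) by simp
    then show ?thesis
      using elliptic_mult[OF x y z(1) zell(1-3)] xy by simp
  qed
qed

end
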